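(* Let $q,a,b,\xi>0$ and let $$f(\theta\mid q,a,b,\xi)=\frac{\Gamma\left(a+\frac1q\right)}{\Gamma\left(\frac1q\right)}\,\frac{q}{2\,B(a,b)}\,\frac{\phi(q)}{\xi^{1/q}}\,\Psi\left(a+\tfrac1q,\;1+\tfrac1q-b,\;\frac{(\phi(q)\,|\theta|)^q}{\xi}\right)\qquad(\theta\in\mathbb{R}).$$ Then $f(\cdot\mid q,a,b,\xi)$ has a singularity at zero if and only if $b\le 1/q$, and its tails behave like $|\theta|^{-aq-1}$; that is, $f(\theta\mid q,a,b,\xi)\sim c\,|\theta|^{-aq-1}$ as $|\theta|\to\infty$ for some constant $c>0$ not depending on $\theta$.
   Context: $\Gamma$ is the Gamma function, $B(a,b)$ the Beta function, and $\phi(q)=\sqrt{\Gamma(3/q)/\Gamma(1/q)}$. "Singularity at zero" means that the density is unbounded at zero. $g\sim h$ means $g/h\to1$. $\Psi(x,y,z)$ is the Tricomi confluent hypergeometric function, given for $y\notin\mathbb{Z}$ by $$\Psi(x,y,z)=\frac{\pi}{\sin(\pi y)}\left\{\frac{M(x,y,z)}{\Gamma(1+x-y)\Gamma(y)}-z^{1-y}\frac{M(1+x-y,2-y,z)}{\Gamma(x)\Gamma(2-y)}\right\},$$ with $M$ the Kummer confluent hypergeometric function; for integer $y$ it is defined by continuity in $y$, and its value at $z=0$ is the limit as $z\to0^+$ (possibly $+\infty$). *)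

theory Defs
  imports "HOL-Analysis.Analysis"
begin

definition kummer_M :: "real \<Rightarrow> real \<Rightarrow> real \<Rightarrow> real" where
  "kummer_M x y z = (\<Sum>n. pochhammer x n / pochhammer y n * z ^ n / fact n)"

text \<open>
  The formula for the Tricomi function at \<open>y \<notin> \<int>\<close> and \<open>z > 0\<close>.  The library's Gamma is \<open>0\<close> at its
  poles and division by \<open>0\<close> yields \<open>0\<close>, so the reciprocal Gamma factors vanish there, as they should.
\<close>

definition tricomi_nonint :: "real \<Rightarrow> real \<Rightarrow> real \<Rightarrow> real" where
  "tricomi_nonint x y z =
     pi / sin (pi * y) *
       (kummer_M x y z / (Gamma (1 + x - y) * Gamma y)
        - z powr (1 - y) * (kummer_M (1 + x - y) (2 - y) z / (Gamma x * Gamma (2 - y))))"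

text \<open>The extension to integer \<open>y\<close> by continuity in \<open>y\<close>, still for \<open>z > 0\<close>.\<close>

definition tricomi_pos :: "real \<Rightarrow> real \<Rightarrow> real \<Rightarrow> real" where
  "tricomi_pos x y z =
     (if y \<in> \<int> then Lim (at y) (\<lambda>t. tricomi_nonint x t z) else tricomi_nonint x y z)"

text \<open>
  The value at \<open>z = 0\<close> is the limit from the right, which may be \<open>\<infinity>\<close>; hence the extended real
  result type.  Only \<open>z \<ge> 0\<close> is meaningful.
\<close>

definition tricomi_Psi :: "real \<Rightarrow> real \<Rightarrow> real \<Rightarrow> ereal" where
  "tricomi_Psi x y z =
     (if z = 0 then Lim (at_right 0) (\<lambda>t. ereal (tricomi_pos x y t))
      else ereal (tricomi_pos x y z))"

definition phi :: "real \<Rightarrow> real" where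
  "phi q = sqrt (Gamma (3 / q) / Gamma (1 / q))"

definition f_density :: "real \<Rightarrow> real \<Rightarrow> real \<Rightarrow> real \<Rightarrow> real \<Rightarrow> ereal" where
  "f_density q a b \<xi> \<theta> =
     ereal (Gamma (a + 1 / q) / Gamma (1 / q) * (q / (2 * Beta a b)) * (phi q / \<xi> powr (1 / q)))
     * tricomi_Psi (a + 1 / q) (1 + 1 / q - b) ((phi q * \<bar>\<theta>\<bar>) powr q / \<xi>)"

text \<open>
  Unboundedness at zero is taken over punctured neighbourhoods: an infinite value at the single
  point \<open>0\<close> does not by itself make a density unbounded.
\<close>

definition singularity_at_zero :: "(real \<Rightarrow> ereal) \<Rightarrow> bool" where
  "singularity_at_zero g \<longleftrightarrow> \<not> (\<exists>K::real. \<forall>\<^sub>F \<theta> in at 0. \<bar>g \<theta>\<bar> \<le> ereal K)"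

end

theory Submission
  imports Defs "HOL-Real_Asymp.Real_Asymp"
begin

text \<open>
  For \<open>x > 0\<close> and \<open>y < 1\<close> the Tricomi function has the representation
  \<open>\<Gamma>(x) \<Psi>(x,y,z) = \<integral> exp(-zv) v^(x-1) (1+v)^(y-x-1) dv\<close> over \<open>v > 0\<close>.  For \<open>0 < y < 1\<close> it follows
  from Kummer's differential equation: the integral and the two Kummer solutions all satisfy it, so
  \<open>z^y exp(-z)\<close> times each Wronskian is constant, and the constants are read off at \<open>z \<rightarrow> 0+\<close>.  The
  contiguous relation \<open>\<Psi>(x,y-1) = \<Psi>(x,y) - x \<Psi>(x+1,y)\<close> extends it to \<open>y < 1\<close>, and
  \<open>\<Psi>(x,y,z) = z^(1-y) \<Psi>(1+x-y,2-y,z)\<close> handles \<open>y > 1\<close>; integer \<open>y\<close> is reached by continuity of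
  the integral in its parameters.  Dominated convergence then yields \<open>z^x \<Psi>(x,y,z) \<rightarrow> 1\<close> at infinity,
  and near \<open>0\<close> the function is bounded exactly when \<open>y < 1\<close>, that is, when \<open>b > 1/q\<close>.
\<close>

subsection \<open>Integrals over the positive half-line\<close>

lemma integrable_on_pos_reals_bounded:
  fixes f h :: "real \<Rightarrow> real"
  assumes "continuous_on {0<..} f" "h integrable_on {0<..}" "\<And>x. x > 0 \<Longrightarrow> \<bar>f x\<bar> \<le> h x"
  shows "f absolutely_integrable_on {0<..}"
  using assms
  by (intro measurable_bounded_by_integrable_imp_absolutely_integrable
        continuous_imp_measurable_on_sets_lebesgue) auto

text \<open>A limit at \<open>a\<close> can be tested along sequences, where the classical dominated
  convergence theorem applies. Domination holds only near \<open>a\<close>, so the first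
  \<open>N\<close> terms of each sequence are discarded.\<close>

lemma dominated_convergence_within:
  fixes f :: "real \<Rightarrow> real \<Rightarrow> real" and h g :: "real \<Rightarrow> real"
  assumes dom: "\<forall>\<^sub>F t in at a within A. continuous_on {0<..} (f t) \<and> (\<forall>x>0. \<bar>f t x\<bar> \<le> h x)"
    and h: "h integrable_on {0<..}"
    and lim: "\<And>x. x > 0 \<Longrightarrow> ((\<lambda>t. f t x) \<longlongrightarrow> g x) (at a within A)"
  shows "((\<lambda>t. integral {0<..} (f t)) \<longlongrightarrow> integral {0<..} g) (at a within A)"
  unfolding tendsto_at_iff_sequentially comp_def
proof (intro allI impI)
  fix X assume X: "\<forall>i. X i \<in> A - {a}" "X \<longlonglongrightarrow> a"
  have flim: "filterlim X (at a within A) sequentially"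
    using X by (auto simp: filterlim_at eventually_sequentially)
  from filterlim_iff[THEN iffD1, OF flim, rule_format, OF dom]
  obtain N where N: "\<And>n. n \<ge> N \<Longrightarrow> continuous_on {0<..} (f (X n)) \<and> (\<forall>x>0. \<bar>f (X n) x\<bar> \<le> h x)"
    by (auto simp: eventually_sequentially)
  have "(\<lambda>n. integral {0<..} (f (X (n + N)))) \<longlonglongrightarrow> integral {0<..} g"
  proof (rule dominated_convergence(2))
    show "f (X (n + N)) integrable_on {0<..}" for n
      using integrable_on_pos_reals_bounded[of "f (X (n + N))" h] N[of "n + N"] h
      by (auto simp: set_lebesgue_integral_eq_integral)
    show "norm (f (X (n + N)) x) \<le> h x" if "x \<in> {0<..}" for n x
      using N[of "n + N"] that by auto
    show "(\<lambda>n. f (X (n + N)) x) \<longlonglongrightarrow> g x" if "x \<in> {0<..}" for x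
      using filterlim_compose[OF lim flim, of x] that by (intro LIMSEQ_ignore_initial_segment) auto
  qed (rule h)
  then show "(\<lambda>n. integral {0<..} (f (X n))) \<longlonglongrightarrow> integral {0<..} g"
    by (rule LIMSEQ_offset)
qed

lemma Gamma_absolutely_integrable:
  assumes "(x::real) > 0"
  shows "(\<lambda>t. exp (- t) * t powr (x - 1)) absolutely_integrable_on {0<..}"
    and "integral {0<..} (\<lambda>t. exp (- t) * t powr (x - 1)) = Gamma x"
proof -
  have "((\<lambda>t. t powr (x - 1) / exp t) has_integral Gamma x) {0<..}"
    using Gamma_integral_real[OF assms]
    by (subst (asm) has_integral_spike_set_eq[where T = "{0<..}"])
       (auto intro!: negligible_subset[OF negligible_sing[of 0]])
  then have *: "((\<lambda>t. exp (- t) * t powr (x - 1)) has_integral Gamma x) {0<..}"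
    by (simp add: exp_minus field_simps)
  then show "(\<lambda>t. exp (- t) * t powr (x - 1)) absolutely_integrable_on {0<..}"
    by (intro nonnegative_absolutely_integrable_1) auto
  show "integral {0<..} (\<lambda>t. exp (- t) * t powr (x - 1)) = Gamma x"
    using * by (rule integral_unique)
qed

lemma integral_pos_reals_scale:
  fixes f :: "real \<Rightarrow> real"
  assumes c: "c > 0"
  shows "(\<lambda>v. c * f (c * v)) absolutely_integrable_on {0<..} \<longleftrightarrow> f absolutely_integrable_on {0<..}"
    and "f absolutely_integrable_on {0<..} \<Longrightarrow>
      integral {0<..} f = integral {0<..} (\<lambda>v. c * f (c * v))"
proof -
  have im: "(*) c ` {0<..} = {0<..}"
  proof (intro set_eqI iffI)
    fix y :: real assume "y \<in> {0<..}" then show "y \<in> (*) c ` {0<..}"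
      using c by (intro image_eqI[of _ _ "y / c"]) auto
  qed (use c in auto)
  \<comment> \<open>The change of variables couples integrability with a prescribed value
    \<open>b\<close>; leaving \<open>b\<close> free lets the two claims be read off
    separately.\<close>
  have *: "(\<lambda>v. \<bar>c\<bar> * f (c * v)) absolutely_integrable_on {0<..} \<and>
           integral {0<..} (\<lambda>v. \<bar>c\<bar> * f (c * v)) = b
     \<longleftrightarrow> f absolutely_integrable_on ((*) c ` {0<..}) \<and> integral ((*) c ` {0<..}) f = b" for b
    by (rule has_absolute_integral_change_of_variables_1')
       (use c in \<open>auto intro!: derivative_eq_intros simp: inj_on_def\<close>)
  show "(\<lambda>v. c * f (c * v)) absolutely_integrable_on {0<..} \<longleftrightarrow> f absolutely_integrable_on {0<..}"
    using * c by (auto simp: im)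
  show "integral {0<..} f = integral {0<..} (\<lambda>v. c * f (c * v))"
    if "f absolutely_integrable_on {0<..}"
    using * c that by (auto simp: im)
qed

text \<open>The half-line is exhausted by the compact intervals \<open>{a n..b n}\<close>. The
  ordinary fundamental theorem holds on each of them, and the truncated integrands are dominated by
  \<open>\<bar>f x\<bar>\<close>.\<close>

lemma integral_pos_reals_FTC:
  fixes F f :: "real \<Rightarrow> real"
  assumes F: "\<And>x. x > 0 \<Longrightarrow> (F has_real_derivative f x) (at x)"
    and f: "f absolutely_integrable_on {0<..}"
    and A: "(F \<longlongrightarrow> A) (at_right 0)" and B: "(F \<longlongrightarrow> B) at_top"
  shows "integral {0<..} f = B - A"
proof -
  define a b :: "nat \<Rightarrow> real" where "a = (\<lambda>n. 1 / (real n + 1))" and "b = (\<lambda>n. real n + 1)"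
  have ab: "a n > 0" "a n \<le> b n" for n
  proof -
    have "a n \<le> 1" "1 \<le> b n" by (simp_all add: a_def b_def)
    then show "a n \<le> b n" by linarith
    show "a n > 0" by (simp add: a_def)
  qed
  have ftc: "(f has_integral F (b n) - F (a n)) {a n..b n}" for n
    using ab[of n] by (intro fundamental_theorem_of_calculus)
      (auto intro!: has_field_derivative_at_within F simp flip: has_real_derivative_iff_has_vector_derivative)
  have restrict: "((\<lambda>x. if x \<in> {a n..b n} then f x else 0) has_integral F (b n) - F (a n)) {0<..}" for n
    using ftc[of n] ab[of n] by (subst has_integral_restrict) auto
  have "(\<lambda>n. integral {0<..} (\<lambda>x. if x \<in> {a n..b n} then f x else 0)) \<longlonglongrightarrow> integral {0<..} f"
  proof (rule dominated_convergence(2))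
    show "(\<lambda>x. \<bar>f x\<bar>) integrable_on {0<..}"
      using f by (simp add: absolutely_integrable_on_def)
    show "(\<lambda>n. if x \<in> {a n..b n} then f x else 0) \<longlonglongrightarrow> f x" if "x \<in> {0<..}" for x
    proof (rule tendsto_eventually)
      have "a \<longlonglongrightarrow> 0" "filterlim b at_top sequentially"
        unfolding a_def b_def by real_asymp+
      then have "\<forall>\<^sub>F n in sequentially. a n < x" "\<forall>\<^sub>F n in sequentially. b n \<ge> x"
        using that by (auto simp: filterlim_at_top intro: order_tendstoD)
      then show "\<forall>\<^sub>F n in sequentially. (if x \<in> {a n..b n} then f x else 0) = f x"
        by eventually_elim auto
    qed
  qed (use restrict in \<open>auto simp: has_integral_integrable\<close>)
  moreover have "(\<lambda>n. integral {0<..} (\<lambda>x. if x \<in> {a n..b n} then f x else 0)) = (\<lambda>n. F (b n) - F (a n))"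
    using integral_unique[OF restrict] by auto
  moreover have "(\<lambda>n. F (b n) - F (a n)) \<longlonglongrightarrow> B - A"
  proof (rule tendsto_diff)
    have "filterlim b at_top sequentially" unfolding b_def by real_asymp
    then show "(\<lambda>n. F (b n)) \<longlonglongrightarrow> B" by (rule filterlim_compose[OF B])
    have "filterlim a (at_right 0) sequentially" unfolding a_def by real_asymp
    then show "(\<lambda>n. F (a n)) \<longlonglongrightarrow> A" by (rule filterlim_compose[OF A])
  qed
  ultimately show ?thesis using LIMSEQ_unique by metis
qed

subsection \<open>The Laplace-type integral\<close>

text \<open>The integrand of the representation of \<open>\<Gamma>(x) \<Psi>(x,y,z)\<close> is the
  case \<open>p = x\<close>, \<open>r = y - x - 1\<close>. With \<open>r\<close> kept separate from
  \<open>p\<close>, differentiation in \<open>z\<close> changes only the sign and raises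
  \<open>p\<close> by one.\<close>

definition laplace_kernel :: "real \<Rightarrow> real \<Rightarrow> real \<Rightarrow> real \<Rightarrow> real" where
  "laplace_kernel p r z v = exp (- (z * v)) * v powr (p - 1) * (1 + v) powr r"

definition laplace_integral :: "real \<Rightarrow> real \<Rightarrow> real \<Rightarrow> real" where
  "laplace_integral p r z = integral {0<..} (laplace_kernel p r z)"

lemma laplace_kernel_nonneg: "laplace_kernel p r z v \<ge> 0"
  by (simp add: laplace_kernel_def)

lemma continuous_on_laplace_kernel: "continuous_on {0<..} (laplace_kernel p r z)"
  unfolding laplace_kernel_def by (intro continuous_intros) auto

text \<open>Exponential decay absorbs any power: \<open>1 + v \<le> k * exp (v / k)\<close> is
  raised to the power \<open>\<bar>r\<bar>\<close>.\<close>

lemma power_bounded_by_exp: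
  fixes z r :: real
  assumes "z > 0"
  obtains C where "C > 0" "\<And>v. v > 0 \<Longrightarrow> (1 + v) powr r \<le> C * exp (z * v)"
proof -
  \<comment> \<open>\<open>k \<ge> 1\<close> gives \<open>1 + v \<le> k * (1 + v / k)\<close>, and
    \<open>k \<ge> \<bar>r\<bar> / z\<close> keeps the resulting rate
    \<open>\<bar>r\<bar> / k\<close> below \<open>z\<close>.\<close>
  define k where "k = max 1 (\<bar>r\<bar> / z)"
  show ?thesis
  proof (rule that)
    show "k powr \<bar>r\<bar> > 0" by (simp add: k_def)
    fix v :: real assume v: "v > 0"
    have k1: "k \<ge> 1" "\<bar>r\<bar> / z \<le> k" by (auto simp: k_def)
    have "(1 + v) powr r \<le> (1 + v) powr \<bar>r\<bar>"
      using v by (intro powr_mono) auto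
    also have "(1 + v) \<le> k * exp (v / k)"
    proof -
      have "1 + v \<le> k * (1 + v / k)" using k1 by (simp add: field_simps)
      also have "\<dots> \<le> k * exp (v / k)" using k1 v by (intro mult_left_mono exp_ge_add_one_self) auto
      finally show ?thesis .
    qed
    then have "(1 + v) powr \<bar>r\<bar> \<le> (k * exp (v / k)) powr \<bar>r\<bar>"
      using v by (intro powr_mono2) auto
    also have "\<dots> = k powr \<bar>r\<bar> * exp (\<bar>r\<bar> * v / k)"
      using k1 by (simp add: powr_mult exp_powr_real mult_ac)
    also have "\<dots> \<le> k powr \<bar>r\<bar> * exp (z * v)"
    proof -
      have "\<bar>r\<bar> * v / k \<le> z * v" using k1 v assms by (simp add: field_simps)
      then show ?thesis by (intro mult_left_mono) auto
    qed
    finally show "(1 + v) powr r \<le> k powr \<bar>r\<bar> * exp (z * v)" .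
  qed
qed

lemma integrable_exp_powr:
  assumes "x > 0" "c > (0::real)"
  shows "(\<lambda>v. exp (- (c * v)) * v powr (x - 1)) integrable_on {0<..}"
proof -
  have "(\<lambda>v. c * (exp (- (c * v)) * (c * v) powr (x - 1))) absolutely_integrable_on {0<..}"
    using Gamma_absolutely_integrable(1)[OF assms(1)] integral_pos_reals_scale(1)[OF assms(2)] by fast
  then have "(\<lambda>v. c * (exp (- (c * v)) * (c * v) powr (x - 1))) integrable_on {0<..}"
    by (simp add: set_lebesgue_integral_eq_integral)
  then have "(\<lambda>v. c powr (-x) * (c * (exp (- (c * v)) * (c * v) powr (x - 1)))) integrable_on {0<..}"
    by (rule integrable_on_mult_right)
  then show ?thesis
    by (rule integrable_spike[where S = "{}"])
       (use assms in \<open>auto simp: powr_mult powr_minus powr_diff field_simps\<close>)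
qed

text \<open>A single majorant serves a whole range of parameters, as limits in \<open>p\<close> and
  \<open>r\<close> and differentiation in \<open>z\<close> require. The smallest exponent
  \<open>p\<close> governs the behaviour at \<open>0\<close>; at infinity half of the exponential
  decay pays for all powers of \<open>1 + v\<close>.\<close>

lemma laplace_kernel_dominated:
  assumes "p > 0" "z > 0"
  obtains h where "h integrable_on {0<..}"
    "\<And>p' r' z' v. p' \<in> {p..p2} \<Longrightarrow> r' \<le> r \<Longrightarrow> z' \<ge> z \<Longrightarrow> v > 0 \<Longrightarrow> \<bar>laplace_kernel p' r' z' v\<bar> \<le> h v"
proof -
  \<comment> \<open>The extra exponent \<open>\<bar>p2 - p\<bar>\<close> compensates for replacing
    \<open>v powr (p' - 1)\<close> by \<open>v powr (p - 1)\<close>.\<close>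
  obtain C where C: "C > 0" "\<And>v. v > 0 \<Longrightarrow> (1 + v) powr (r + \<bar>p2 - p\<bar>) \<le> C * exp (z / 2 * v)"
    using power_bounded_by_exp[of "z / 2" "r + \<bar>p2 - p\<bar>"] assms by auto
  show ?thesis
  proof (rule that)
    show "(\<lambda>v. C * (exp (- (z / 2 * v)) * v powr (p - 1))) integrable_on {0<..}"
      using assms by (intro integrable_on_mult_right integrable_exp_powr) auto
    fix p' r' z' v :: real assume *: "p' \<in> {p..p2}" "r' \<le> r" "z' \<ge> z" "v > 0"
    have "v powr (p' - 1) = v powr (p - 1) * v powr (p' - p)"
      by (simp flip: powr_add)
    also have "\<dots> \<le> v powr (p - 1) * (1 + v) powr (p' - p)"
      using * by (intro mult_left_mono powr_mono2) auto
    also have "\<dots> \<le> v powr (p - 1) * (1 + v) powr \<bar>p2 - p\<bar>"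
      using * by (intro mult_left_mono powr_mono) auto
    finally have 1: "v powr (p' - 1) \<le> v powr (p - 1) * (1 + v) powr \<bar>p2 - p\<bar>" .
    have 2: "(1 + v) powr r' \<le> (1 + v) powr r"
      using * by (intro powr_mono) auto
    have 3: "exp (- (z' * v)) \<le> exp (- (z * v))" using * by simp
    have "laplace_kernel p' r' z' v \<le> exp (- (z * v)) * (v powr (p - 1) * (1 + v) powr \<bar>p2 - p\<bar>) * (1 + v) powr r"
      unfolding laplace_kernel_def by (intro mult_mono 1 2 3) auto
    also have "\<dots> = exp (- (z * v)) * v powr (p - 1) * (1 + v) powr (r + \<bar>p2 - p\<bar>)"
      by (simp add: powr_add)
    also have "\<dots> \<le> exp (- (z * v)) * v powr (p - 1) * (C * exp (z / 2 * v))"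
      using * by (intro mult_left_mono C) auto
    also have "\<dots> = C * (exp (- (z / 2 * v)) * v powr (p - 1))"
      by (simp add: field_simps flip: exp_add)
    finally show "\<bar>laplace_kernel p' r' z' v\<bar> \<le> C * (exp (- (z / 2 * v)) * v powr (p - 1))"
      using laplace_kernel_nonneg[of p' r' z' v] by simp
  qed
qed

lemma laplace_kernel_integrable:
  assumes "p > 0" "z > 0"
  shows "laplace_kernel p r z absolutely_integrable_on {0<..}" "laplace_kernel p r z integrable_on {0<..}"
proof -
  obtain h where h: "h integrable_on {0<..}"
    "\<And>p' r' z' v. p' \<in> {p..p} \<Longrightarrow> r' \<le> r \<Longrightarrow> z' \<ge> z \<Longrightarrow> v > 0 \<Longrightarrow> \<bar>laplace_kernel p' r' z' v\<bar> \<le> h v"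
    using laplace_kernel_dominated[OF assms] by blast
  show "laplace_kernel p r z absolutely_integrable_on {0<..}"
    by (rule integrable_on_pos_reals_bounded[OF continuous_on_laplace_kernel h(1)]) (auto intro: h(2))
  then show "laplace_kernel p r z integrable_on {0<..}"
    by (simp add: set_lebesgue_integral_eq_integral)
qed

text \<open>One factor \<open>1 + v\<close> of the kernel is expanded. This is the integral
  counterpart of the contiguous relation in \<open>tricomi_nonint_descent\<close>.\<close>

lemma laplace_integral_split:
  assumes "p > 0" "z > 0"
  shows "laplace_integral p (r + 1) z = laplace_integral p r z + laplace_integral (p + 1) r z"
proof -
  have "laplace_integral p r z + laplace_integral (p + 1) r z = integral {0<..} (\<lambda>v. laplace_kernel p r z v + laplace_kernel (p + 1) r z v)"
    unfolding laplace_integral_def using assms by (intro integral_add[symmetric] laplace_kernel_integrable) auto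
  also have "\<dots> = laplace_integral p (r + 1) z"
    unfolding laplace_integral_def
  proof (rule integral_cong)
    fix v :: real assume "v \<in> {0<..}"
    then show "laplace_kernel p r z v + laplace_kernel (p + 1) r z v = laplace_kernel p (r + 1) z v"
      by (simp add: laplace_kernel_def powr_add powr_diff field_simps)
  qed
  finally show ?thesis by simp
qed

text \<open>Joint continuity in the two exponents, used to reach integer \<open>y\<close>. The
  window from \<open>p / 2\<close> to \<open>p + 1\<close> eventually contains \<open>P t\<close>
  and stays away from the exponent \<open>0\<close>, where integrability near \<open>v = 0\<close>
  is lost.\<close>

lemma tendsto_laplace_integral:
  fixes P R :: "real \<Rightarrow> real"
  assumes "p > 0" "z > 0"
    and P: "(P \<longlongrightarrow> p) (at a within A)" and R: "(R \<longlongrightarrow> r) (at a within A)"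
  shows "((\<lambda>t. laplace_integral (P t) (R t) z) \<longlongrightarrow> laplace_integral p r z) (at a within A)"
proof -
  obtain h where h: "h integrable_on {0<..}"
    "\<And>p' r' z' v. p' \<in> {p / 2..p + 1} \<Longrightarrow> r' \<le> r + 1 \<Longrightarrow> z' \<ge> z \<Longrightarrow> v > 0 \<Longrightarrow> \<bar>laplace_kernel p' r' z' v\<bar> \<le> h v"
    using laplace_kernel_dominated[of "p / 2" z "p + 1" "r + 1"] assms by auto
  have "\<forall>\<^sub>F t in at a within A. P t > p / 2" "\<forall>\<^sub>F t in at a within A. P t < p + 1"
       "\<forall>\<^sub>F t in at a within A. R t < r + 1"
    using assms order_tendstoD(1)[OF P, of "p / 2"] order_tendstoD(2)[OF P, of "p + 1"]
      order_tendstoD(2)[OF R, of "r + 1"] by auto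
  then have ev: "\<forall>\<^sub>F t in at a within A.
      continuous_on {0<..} (laplace_kernel (P t) (R t) z) \<and> (\<forall>x>0. \<bar>laplace_kernel (P t) (R t) z x\<bar> \<le> h x)"
    by eventually_elim (auto intro!: continuous_on_laplace_kernel h(2))
  show ?thesis
    unfolding laplace_integral_def
  proof (rule dominated_convergence_within[where f = "\<lambda>t. laplace_kernel (P t) (R t) z", OF ev h(1)])
    fix x :: real assume "x > 0"
    then show "((\<lambda>t. laplace_kernel (P t) (R t) z x) \<longlongrightarrow> laplace_kernel p r z x) (at a within A)"
      unfolding laplace_kernel_def by (intro tendsto_intros P R) auto
  qed
qed

section \<open>Kummer's differential equation for the Laplace-type integral\<close>

text \<open>Differentiation under the integral sign: the difference quotients \<open>D w\<close>
  converge pointwise, and the mean value inequality bounds them by a majorant of the differentiated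
  kernel that is valid for all arguments beyond \<open>z / 2\<close>.\<close>

lemma has_field_derivative_laplace_integral:
  assumes p: "p > 0" and z: "z > 0"
  shows "(laplace_integral p r has_field_derivative - laplace_integral (p + 1) r z) (at z)"
proof -
  obtain h where h: "h integrable_on {0<..}"
    "\<And>p' r' z' v. p' \<in> {p + 1..p + 1} \<Longrightarrow> r' \<le> r \<Longrightarrow> z' \<ge> z / 2 \<Longrightarrow> v > 0 \<Longrightarrow> \<bar>laplace_kernel p' r' z' v\<bar> \<le> h v"
    using laplace_kernel_dominated[of "p + 1" "z / 2" "p + 1" r] assms by auto
  define D where "D = (\<lambda>w v. (laplace_kernel p r w v - laplace_kernel p r z v) / (w - z))"
  have der: "((\<lambda>w. laplace_kernel p r w v) has_field_derivative - laplace_kernel (p + 1) r w v) (at w)"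
    if "v > 0" for v w
    unfolding laplace_kernel_def using that
    by (auto intro!: derivative_eq_intros simp: powr_diff field_simps)
  have ev: "\<forall>\<^sub>F w in at z. w > z / 2 \<and> w \<noteq> z"
    using z order_tendstoD(1)[OF tendsto_ident_at, of "z/2" z UNIV]
    by (auto simp: eventually_conj_iff eventually_neq_at_within)
  have "((\<lambda>w. integral {0<..} (D w)) \<longlongrightarrow> integral {0<..} (\<lambda>v. - laplace_kernel (p + 1) r z v)) (at z)"
  proof (rule dominated_convergence_within[OF _ h(1)])
    show "\<forall>\<^sub>F t in at z. continuous_on {0<..} (D t) \<and> (\<forall>x>0. \<bar>D t x\<bar> \<le> h x)"
      using ev
    proof eventually_elim
      case (elim w)
      have "\<bar>D w v\<bar> \<le> h v" if v: "v > 0" for v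
      proof -
        have "\<bar>laplace_kernel p r w v - laplace_kernel p r z v\<bar> \<le> h v * \<bar>w - z\<bar>"
        proof (rule field_differentiable_bound[where S = "{z/2<..}"
              and f' = "\<lambda>u. - laplace_kernel (p + 1) r u v", unfolded real_norm_def])
          show "((\<lambda>w. laplace_kernel p r w v) has_field_derivative - laplace_kernel (p + 1) r u v) (at u within {z/2<..})" for u
            using der[OF v] by (rule has_field_derivative_at_within)
          show "\<bar>- laplace_kernel (p + 1) r u v\<bar> \<le> h v" if "u \<in> {z/2<..}" for u
            using h(2)[of "p + 1" r u v] that v by auto
        qed (use elim z in auto)
        then show ?thesis using elim by (simp add: D_def divide_le_eq)
      qed
      moreover have "continuous_on {0<..} (D w)"
        unfolding D_def using elim by (intro continuous_intros continuous_on_laplace_kernel) auto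
      ultimately show ?case by blast
    qed
    show "((\<lambda>t. D t x) \<longlongrightarrow> - laplace_kernel (p + 1) r z x) (at z)" if "x > 0" for x
      using der[OF that, of z] unfolding D_def by (simp add: has_field_derivative_iff)
  qed
  moreover have "\<forall>\<^sub>F w in at z. integral {0<..} (D w) = (laplace_integral p r w - laplace_integral p r z) / (w - z)"
    using ev
  proof eventually_elim
    case (elim w)
    have "integral {0<..} (\<lambda>v. laplace_kernel p r w v - laplace_kernel p r z v) = laplace_integral p r w - laplace_integral p r z"
      unfolding laplace_integral_def using elim assms by (intro integral_diff laplace_kernel_integrable) auto
    then show ?case by (simp add: D_def)
  qed
  ultimately show ?thesis
    unfolding has_field_derivative_iff laplace_integral_def by (simp add: filterlim_cong)
qed

text \<open>The derivative of \<open>exp (- (z * t)) * t powr p * (1 + t) powr (r + 1)\<close> is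
  integrated; the boundary terms vanish at \<open>0\<close> because \<open>p > 0\<close> and at
  infinity because \<open>z > 0\<close>.\<close>

lemma laplace_integral_by_parts:
  assumes p: "p > 0" and z: "z > 0"
  shows "z * laplace_integral (p + 1) (r + 1) z = p * laplace_integral p (r + 1) z + (r + 1) * laplace_integral (p + 1) r z"
proof -
  define F where "F = (\<lambda>t. exp (- (z * t)) * t powr p * (1 + t) powr (r + 1))"
  define f where "f = (\<lambda>t. p * laplace_kernel p (r + 1) z t + (r + 1) * laplace_kernel (p + 1) r z t
      - z * laplace_kernel (p + 1) (r + 1) z t)"
  have int: "f absolutely_integrable_on {0<..}"
    unfolding f_def using assms
    by (intro set_integral_diff set_integral_add set_integrable_mult_right laplace_kernel_integrable) auto
  have "integral {0<..} f = 0 - 0"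
  proof (rule integral_pos_reals_FTC[OF _ int])
    show "(F has_real_derivative f t) (at t)" if "t > 0" for t
      unfolding F_def f_def laplace_kernel_def using that
      by (auto intro!: derivative_eq_intros simp: powr_diff field_simps)
    show "(F \<longlongrightarrow> 0) (at_right 0)"
    proof -
      have "(F \<longlongrightarrow> exp (- (z * 0)) * 0 powr p * (1 + 0) powr (r + 1)) (at_right 0)"
        unfolding F_def using p
        by (intro tendsto_intros) (auto intro: eventually_at_right_less[THEN eventually_mono])
      then show ?thesis using p by simp
    qed
    show "(F \<longlongrightarrow> 0) at_top"
      unfolding F_def using z by real_asymp
  qed
  moreover have "integral {0<..} f = p * laplace_integral p (r + 1) z + (r + 1) * laplace_integral (p + 1) r z - z * laplace_integral (p + 1) (r + 1) z"
  proof -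
    have "(f has_integral (p * laplace_integral p (r + 1) z + (r + 1) * laplace_integral (p + 1) r z - z * laplace_integral (p + 1) (r + 1) z)) {0<..}"
      unfolding f_def laplace_integral_def using assms
      by (intro has_integral_diff has_integral_add has_integral_mult_right integrable_integral laplace_kernel_integrable) auto
    then show ?thesis by (rule integral_unique)
  qed
  ultimately show ?thesis by simp
qed

text \<open>Kummer's equation \<open>z * w'' + (y - z) * w' - x * w = 0\<close> with
  \<open>x = p\<close> and \<open>y = p + r + 1\<close>, as each derivative raises \<open>p\<close>
  and changes the sign. Two instances of \<open>laplace_integral_split\<close> remove the exponent
  \<open>r + 1\<close> from the integration by parts.\<close>

lemma laplace_integral_ode:
  assumes p: "p > 0" and z: "z > 0"
  shows "z * laplace_integral (p + 2) r z + (p + r + 1 - z) * (- laplace_integral (p + 1) r z) - p * laplace_integral p r z = 0"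
  using laplace_integral_by_parts[OF assms, of r] laplace_integral_split[OF assms, of r] laplace_integral_split[of "p + 1" z r] assms
  by (simp add: algebra_simps)

section \<open>Limits of the Laplace-type integral at infinity and at zero\<close>

lemma laplace_integral_scale:
  assumes p: "p > 0" and z: "z > 0"
  shows "laplace_integral p r z = z powr (- p) * integral {0<..} (\<lambda>v. exp (- v) * v powr (p - 1) * (1 + v / z) powr r)"
proof -
  have "laplace_integral p r z = integral {0<..} (\<lambda>v. (1 / z) * laplace_kernel p r z (1 / z * v))"
    unfolding laplace_integral_def using assms by (intro integral_pos_reals_scale laplace_kernel_integrable) auto
  also have "\<dots> = integral {0<..} (\<lambda>v. z powr (- p) * (exp (- v) * v powr (p - 1) * (1 + v / z) powr r))"
    using assms by (intro integral_cong) (auto simp: laplace_kernel_def powr_divide powr_minus powr_diff field_simps)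
  finally show ?thesis by simp
qed

text \<open>After rescaling, the only dependence on \<open>w = 1 / z\<close> is the factor
  \<open>(1 + v * w) powr r\<close>, which is at most \<open>1\<close> because
  \<open>r \<le> 0\<close> and tends to \<open>1\<close> as \<open>w\<close> tends to
  \<open>0\<close>.\<close>

lemma laplace_integral_at_top:
  assumes p: "p > 0" and r: "r \<le> 0"
  shows "((\<lambda>z. z powr p * laplace_integral p r z) \<longlongrightarrow> Gamma p) at_top"
proof -
  define f where "f = (\<lambda>w v. exp (- v) * v powr (p - 1) * (1 + v * w) powr r)"
  have "((\<lambda>w. integral {0<..} (f w)) \<longlongrightarrow> integral {0<..} (\<lambda>v. exp (- v) * v powr (p - 1))) (at_right 0)"
  proof (rule dominated_convergence_within)
    show "(\<lambda>v. exp (- v) * v powr (p - 1)) integrable_on {0<..}"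
      using Gamma_absolutely_integrable(1)[OF p] by (simp add: set_lebesgue_integral_eq_integral)
    show "\<forall>\<^sub>F w in at_right 0. continuous_on {0<..} (f w) \<and> (\<forall>v>0. \<bar>f w v\<bar> \<le> exp (- v) * v powr (p - 1))"
      using eventually_at_right_less[of 0]
    proof eventually_elim
      case (elim w)
      have "continuous_on {0<..} (f w)"
        unfolding f_def using elim by (intro continuous_intros) (auto simp: add_nonneg_eq_0_iff)
      moreover have "(1 + v * w) powr r \<le> 1" if "v > 0" for v
        using powr_mono[of r 0 "1 + v * w"] elim that r
        by (simp add: add_pos_pos less_imp_neq[symmetric])
      ultimately show ?case
        by (auto simp: f_def abs_mult intro!: mult_left_le)
    qed
    show "((\<lambda>w. f w v) \<longlongrightarrow> exp (- v) * v powr (p - 1)) (at_right 0)" if "v > 0" for v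
    proof -
      have "((\<lambda>w. f w v) \<longlongrightarrow> exp (- v) * v powr (p - 1) * (1 + v * 0) powr r) (at_right 0)"
        unfolding f_def by (intro tendsto_intros) auto
      then show ?thesis by simp
    qed
  qed
  then have "((\<lambda>w. integral {0<..} (f w)) \<longlongrightarrow> Gamma p) (at_right 0)"
    using Gamma_absolutely_integrable(2)[OF p] by simp
  moreover have "filterlim (\<lambda>z::real. 1 / z) (at_right 0) at_top" by real_asymp
  ultimately have "((\<lambda>z. integral {0<..} (f (1 / z))) \<longlongrightarrow> Gamma p) at_top"
    by (rule filterlim_compose)
  moreover have "\<forall>\<^sub>F z in at_top. integral {0<..} (f (1 / z)) = z powr p * laplace_integral p r z"
    using eventually_gt_at_top[of 0]
    by eventually_elim (use p in \<open>simp add: laplace_integral_scale f_def flip: mult.assoc powr_add\<close>)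
  ultimately show ?thesis by (rule Lim_transform_eventually)
qed

text \<open>For \<open>p + r > 0\<close> the kernel at \<open>z = 0\<close> is not integrable at
  infinity, and the integral blows up. Rescaling turns \<open>z powr r * (1 + v / z) powr r\<close>
  into \<open>(z + v) powr r\<close>, which is at most \<open>v powr r\<close> and converges to
  it.\<close>

lemma laplace_integral_at_0_singular:
  assumes p: "p > 0" and r: "r \<le> 0" and pr: "p + r > 0"
  shows "((\<lambda>z. z powr (p + r) * laplace_integral p r z) \<longlongrightarrow> Gamma (p + r)) (at_right 0)"
proof -
  define f where "f = (\<lambda>z v. exp (- v) * v powr (p - 1) * (z + v) powr r)"
  have "((\<lambda>z. integral {0<..} (f z)) \<longlongrightarrow> integral {0<..} (\<lambda>v. exp (- v) * v powr (p + r - 1))) (at_right 0)"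
  proof (rule dominated_convergence_within)
    show "(\<lambda>v. exp (- v) * v powr (p + r - 1)) integrable_on {0<..}"
      using Gamma_absolutely_integrable(1)[OF pr] by (simp add: set_lebesgue_integral_eq_integral)
    show "\<forall>\<^sub>F z in at_right 0. continuous_on {0<..} (f z) \<and> (\<forall>v>0. \<bar>f z v\<bar> \<le> exp (- v) * v powr (p + r - 1))"
      using eventually_at_right_less[of 0]
    proof eventually_elim
      case (elim z)
      have "continuous_on {0<..} (f z)"
        unfolding f_def using elim by (intro continuous_intros) auto
      moreover have "\<bar>f z v\<bar> \<le> exp (- v) * v powr (p + r - 1)" if "v > 0" for v
      proof -
        have "(z + v) powr r \<le> v powr r"
          using powr_mono2'[of r v "z + v"] elim that r by auto
        then have "f z v \<le> exp (- v) * v powr (p - 1) * v powr r"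
          unfolding f_def by (intro mult_left_mono) auto
        also have "\<dots> = exp (- v) * v powr (p + r - 1)"
          using that by (simp add: powr_add powr_diff)
        finally show ?thesis by (simp add: f_def)
      qed
      ultimately show ?case by blast
    qed
    show "((\<lambda>w. f w v) \<longlongrightarrow> exp (- v) * v powr (p + r - 1)) (at_right 0)" if "v > 0" for v
    proof -
      have "((\<lambda>w. f w v) \<longlongrightarrow> exp (- v) * v powr (p - 1) * (0 + v) powr r) (at_right 0)"
        unfolding f_def using that by (intro tendsto_intros) auto
      then show ?thesis using that by (simp add: powr_add powr_diff mult_ac)
    qed
  qed
  then have "((\<lambda>w. integral {0<..} (f w)) \<longlongrightarrow> Gamma (p + r)) (at_right 0)"
    using Gamma_absolutely_integrable(2)[OF pr] by simp
  moreover have "\<forall>\<^sub>F z in at_right 0. integral {0<..} (f z) = z powr (p + r) * laplace_integral p r z"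
    using eventually_at_right_less[of 0]
  proof eventually_elim
    case (elim z)
    have "z powr (p + r) * laplace_integral p r z
      = z powr r * integral {0<..} (\<lambda>v. exp (- v) * v powr (p - 1) * (1 + v / z) powr r)"
      using elim p by (simp add: laplace_integral_scale powr_add powr_minus field_simps)
    also have "\<dots> = integral {0<..} (\<lambda>v. z powr r * (exp (- v) * v powr (p - 1) * (1 + v / z) powr r))"
      by simp
    also have "\<dots> = integral {0<..} (f z)"
    proof (rule integral_cong)
      fix v :: real assume "v \<in> {0<..}"
      then have "z powr r * (1 + v / z) powr r = (z * (1 + v / z)) powr r"
        using elim by (intro powr_mult[symmetric])
      also have "z * (1 + v / z) = z + v" using elim by (simp add: field_simps)
      finally show "z powr r * (exp (- v) * v powr (p - 1) * (1 + v / z) powr r) = f z v"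
        by (simp add: f_def mult_ac)
    qed
    finally show ?case ..
  qed
  ultimately show ?thesis by (rule Lim_transform_eventually)
qed

text \<open>The substitution \<open>t = v / (1 + v)\<close> in Euler's Beta integral, with
  \<open>1 - t = 1 / (1 + v)\<close> and Jacobian \<open>1 / (1 + v)\<^sup>2\<close>.\<close>

lemma Beta_integral_pos_reals:
  assumes p: "p > 0" and s: "s > (0::real)"
  shows "(\<lambda>v. v powr (p - 1) * (1 + v) powr (- (p + s))) absolutely_integrable_on {0<..}"
    and "integral {0<..} (\<lambda>v. v powr (p - 1) * (1 + v) powr (- (p + s))) = Beta p s"
proof -
  define f where "f = (\<lambda>t::real. t powr (p - 1) * (1 - t) powr (s - 1))"
  define g g' where "g = (\<lambda>v::real. v / (1 + v))" and "g' = (\<lambda>v::real. 1 / (1 + v)\<^sup>2)"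
  have "(f has_integral Beta p s) {0<..<1}"
    unfolding f_def using has_integral_Beta_real[OF p s] by (simp add: has_integral_Icc_iff_Ioo)
  then have f: "f absolutely_integrable_on {0<..<1}" "integral {0<..<1} f = Beta p s"
    by (auto intro!: nonnegative_absolutely_integrable_1 simp: f_def integral_unique has_integral_integrable)
  have im: "g ` {0<..} = {0<..<1}"
  proof (intro set_eqI iffI)
    fix t assume "t \<in> {0<..<(1::real)}"
    then show "t \<in> g ` {0<..}"
      by (intro image_eqI[of _ _ "t / (1 - t)"]) (auto simp: g_def field_simps)
  qed (auto simp: g_def field_simps)
  have "(\<lambda>v. \<bar>g' v\<bar> * f (g v)) absolutely_integrable_on {0<..} \<and>
           integral {0<..} (\<lambda>v. \<bar>g' v\<bar> * f (g v)) = Beta p s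
     \<longleftrightarrow> f absolutely_integrable_on (g ` {0<..}) \<and> integral (g ` {0<..}) f = Beta p s"
  proof (rule has_absolute_integral_change_of_variables_1')
    show "(g has_field_derivative g' v) (at v within {0<..})" if "v \<in> {0<..}" for v
      unfolding g_def g'_def using that
      by (auto intro!: derivative_eq_intros simp: field_simps power2_eq_square)
    show "inj_on g {0<..}" by (auto simp: inj_on_def g_def field_simps)
  qed auto
  then have *: "(\<lambda>v. \<bar>g' v\<bar> * f (g v)) absolutely_integrable_on {0<..}"
    "integral {0<..} (\<lambda>v. \<bar>g' v\<bar> * f (g v)) = Beta p s"
    using f im by auto
  have eq: "\<bar>g' v\<bar> * f (g v) = v powr (p - 1) * (1 + v) powr (- (p + s))" if "v \<in> {0<..}" for v
  proof -
    have "1 - v / (1 + v) = 1 / (1 + v)" using that by (simp add: field_simps)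
    then have "\<bar>g' v\<bar> * f (g v) = v powr (p - 1) * ((1 + v) powr (-2) * (1 + v) powr (1 - p) * (1 + v) powr (1 - s))"
      using that
      by (simp add: f_def g_def g'_def powr_divide powr_minus powr_diff field_simps)
    also have "(1 + v) powr (-2) * (1 + v) powr (1 - p) * (1 + v) powr (1 - s) = (1 + v) powr (- (p + s))"
      unfolding powr_add[symmetric] by (rule arg_cong[where f = "\<lambda>e. (1 + v) powr e"]) simp
    finally show ?thesis .
  qed
  have "integral {0<..} (\<lambda>v. \<bar>g' v\<bar> * f (g v))
      = integral {0<..} (\<lambda>v. v powr (p - 1) * (1 + v) powr (- (p + s)))"
    by (rule integral_cong) (rule eq)
  then show "integral {0<..} (\<lambda>v. v powr (p - 1) * (1 + v) powr (- (p + s))) = Beta p s"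
    using *(2) by simp
  show "(\<lambda>v. v powr (p - 1) * (1 + v) powr (- (p + s))) absolutely_integrable_on {0<..}"
    by (rule set_integrable_cong[THEN iffD1, OF refl refl _ *(1)]) (rule eq)
qed

text \<open>For \<open>p + r < 0\<close> the kernel at \<open>z = 0\<close> is integrable and
  dominates all kernels with \<open>z > 0\<close>; its integral is a Beta value.\<close>

lemma laplace_integral_at_0:
  assumes p: "p > 0" and pr: "p + r < 0"
  shows "((\<lambda>z. laplace_integral p r z) \<longlongrightarrow> Beta p (- (p + r))) (at_right 0)"
proof -
  have K0: "laplace_kernel p r 0 = (\<lambda>v. v powr (p - 1) * (1 + v) powr r)"
    by (auto simp: laplace_kernel_def)
  have "((\<lambda>z. integral {0<..} (\<lambda>v. laplace_kernel p r z v)) \<longlongrightarrow> integral {0<..} (laplace_kernel p r 0)) (at_right 0)"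
  proof (rule dominated_convergence_within)
    show "laplace_kernel p r 0 integrable_on {0<..}"
      unfolding K0 using Beta_integral_pos_reals(1)[of p "- (p + r)"] assms
      by (simp add: set_lebesgue_integral_eq_integral)
    show "\<forall>\<^sub>F z in at_right 0. continuous_on {0<..} (laplace_kernel p r z) \<and> (\<forall>x>0. \<bar>laplace_kernel p r z x\<bar> \<le> laplace_kernel p r 0 x)"
      using eventually_at_right_less[of 0]
      by eventually_elim (intro conjI continuous_on_laplace_kernel, auto simp: laplace_kernel_def intro!: mult_right_mono)
    show "((\<lambda>z. laplace_kernel p r z x) \<longlongrightarrow> laplace_kernel p r 0 x) (at_right 0)" for x
      unfolding laplace_kernel_def by (intro tendsto_intros)
  qed
  then show ?thesis
    unfolding laplace_integral_def K0 using Beta_integral_pos_reals(2)[of p "- (p + r)"] assms by simp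
qed

lemma laplace_integral_antimono:
  assumes "p > 0" "0 < z" "z \<le> w"
  shows "laplace_integral p r w \<le> laplace_integral p r z"
  unfolding laplace_integral_def using assms
  by (intro integral_le laplace_kernel_integrable) (auto simp: laplace_kernel_def intro!: mult_right_mono)

text \<open>The borderline \<open>r = - p\<close>, corresponding to \<open>y = 1\<close>. For
  \<open>v\<close> between \<open>1\<close> and \<open>1 / z\<close> the exponential is at least
  \<open>exp (- 1)\<close> and \<open>1 + v \<le> 2 * v\<close>, so the kernel is at least a
  constant times \<open>1 / v\<close>, whose integral is the logarithm.\<close>

lemma laplace_integral_log_lower_bound:
  assumes p: "p > 0" and z: "0 < z" "z \<le> 1"
  shows "exp (- 1) * 2 powr (- p) * ln (1 / z) \<le> laplace_integral p (- p) z"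
proof -
  define c where "c = exp (- 1) * 2 powr (- p)"
  have "((\<lambda>v. c * (1 / v)) has_integral c * (ln (1 / z) - ln 1)) {1..1 / z}"
    using z by (intro has_integral_mult_right fundamental_theorem_of_calculus)
      (auto intro!: derivative_eq_intros simp flip: has_real_derivative_iff_has_vector_derivative)
  then have "c * ln (1 / z) = integral {1..1 / z} (\<lambda>v. c * (1 / v))" "(\<lambda>v. c * (1 / v)) integrable_on {1..1 / z}"
    by (auto simp: integral_unique has_integral_integrable)
  note this(1)
  also have "integral {1..1 / z} (\<lambda>v. c * (1 / v)) \<le> integral {0<..} (laplace_kernel p (- p) z)"
  proof -
    have "integral {1..1 / z} (\<lambda>v. c * (1 / v)) \<le> integral {1..1 / z} (laplace_kernel p (- p) z)"
    proof (rule integral_le)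
      show "(\<lambda>v. c * (1 / v)) integrable_on {1..1 / z}" by fact
      show "laplace_kernel p (- p) z integrable_on {1..1 / z}"
        by (intro integrable_continuous_real continuous_on_subset[OF continuous_on_laplace_kernel]) auto
      fix v assume v: "v \<in> {1..1 / z}"
      have "exp (- 1) \<le> exp (- (z * v))" using v z by (simp add: field_simps)
      moreover have "2 powr (- p) * v powr (- p) \<le> (1 + v) powr (- p)"
        using v p powr_mono2'[of "- p" "1 + v" "2 * v"] by (simp add: powr_mult)
      ultimately have "exp (- 1) * (v powr (p - 1) * (2 powr (- p) * v powr (- p))) \<le> laplace_kernel p (- p) z v"
        unfolding laplace_kernel_def mult.assoc by (intro mult_mono) auto
      moreover have "exp (- 1) * (v powr (p - 1) * (2 powr (- p) * v powr (- p))) = c * (1 / v)"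
        using v by (simp add: c_def powr_diff powr_minus field_simps)
      ultimately show "c * (1 / v) \<le> laplace_kernel p (- p) z v" by simp
    qed
    also have "\<dots> \<le> integral {0<..} (laplace_kernel p (- p) z)"
      using assms
      by (intro integral_subset_le laplace_kernel_integrable integrable_continuous_real
            continuous_on_subset[OF continuous_on_laplace_kernel]) (auto simp: laplace_kernel_nonneg)
    finally show ?thesis .
  qed
  finally show ?thesis unfolding c_def laplace_integral_def .
qed

subsection \<open>Kummer's series\<close>

definition kummer_coeff :: "real \<Rightarrow> real \<Rightarrow> nat \<Rightarrow> real" where
  "kummer_coeff x y n = pochhammer x n / pochhammer y n / fact n"

lemma kummer_coeff_Suc:
  "kummer_coeff x y (Suc n) = kummer_coeff x y n * ((x + n) / ((y + n) * (n + 1)))"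
  by (simp add: kummer_coeff_def pochhammer_Suc mult_ac)

text \<open>Peels off the first factor of both Pochhammer symbols rather than the last, which is the
  form that termwise differentiation produces.\<close>

lemma kummer_coeff_Suc':
  "kummer_coeff x y (Suc n) = x / y * kummer_coeff (x + 1) (y + 1) n / (n + 1)"
  by (simp add: kummer_coeff_def pochhammer_rec mult_ac)

lemma kummer_coeff_0 [simp]: "kummer_coeff x y 0 = 1"
  by (simp add: kummer_coeff_def)

lemma kummer_coeff_plus1_left: "x * kummer_coeff (x + 1) y n = (x + n) * kummer_coeff x y n"
proof -
  have "x * pochhammer (x + 1) n = (x + n) * pochhammer x n"
    by (metis pochhammer_Suc pochhammer_rec mult.commute)
  then show ?thesis by (simp add: kummer_coeff_def)
qed

lemma nonint_add_of_nat_neq_0: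
  assumes "(y::real) \<notin> \<int>" shows "y + real n \<noteq> 0"
proof
  assume "y + real n = 0"
  then have "y = of_int (- int n)" by simp
  then show False using assms by (metis Ints_of_int)
qed

lemma pochhammer_nonint: "(y::real) \<notin> \<int> \<Longrightarrow> pochhammer y n \<noteq> 0"
  by (metis (no_types) add.commute nonint_add_of_nat_neq_0 pochhammer_eq_0_iff add.right_inverse)

lemma kummer_coeff_plus1_right:
  assumes "y \<notin> \<int>"
  shows "kummer_coeff x (y + 1) n = kummer_coeff x y n * y / (y + n)"
proof -
  have "y * pochhammer (y + 1) n = (y + n) * pochhammer y n"
    by (metis pochhammer_Suc pochhammer_rec mult.commute)
  moreover have y0: "y \<noteq> 0" using assms by auto
  ultimately have eq: "pochhammer (y + 1) n = (y + n) * pochhammer y n / y"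
    by (simp add: field_simps)
  show ?thesis unfolding kummer_coeff_def eq
    using y0 pochhammer_nonint[OF assms, of n] nonint_add_of_nat_neq_0[OF assms, of n] by simp
qed

text \<open>Ratio test: the quotient of consecutive terms tends to \<open>0\<close> for every
  \<open>z\<close>.\<close>

lemma kummer_sums:
  assumes "y \<notin> \<int>"
  shows "(\<lambda>n. kummer_coeff x y n * z ^ n) sums kummer_M x y z"
proof -
  define f where "f = (\<lambda>n. kummer_coeff x y n * z ^ n)"
  have "(\<lambda>n. (x + real n) * z / ((y + real n) * (real n + 1))) \<longlonglongrightarrow> 0"
    by real_asymp
  from order_tendstoD(2)[OF tendsto_rabs_zero[OF this], of "1 / 2"]
  have "\<forall>\<^sub>F n in sequentially. \<bar>(x + real n) * z / ((y + real n) * (real n + 1))\<bar> < 1 / 2"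
    by simp
  then obtain N where N: "\<And>n. n \<ge> N \<Longrightarrow> \<bar>(x + real n) * z / ((y + real n) * (real n + 1))\<bar> < 1 / 2"
    by (auto simp: eventually_sequentially)
  have "summable f"
  proof (rule summable_ratio_test)
    show "norm (f (Suc n)) \<le> 1 / 2 * norm (f n)" if "n \<ge> N" for n
    proof -
      have "f (Suc n) = ((x + real n) * z / ((y + real n) * (real n + 1))) * f n"
        by (simp add: f_def kummer_coeff_Suc mult_ac)
      then show ?thesis
        using mult_right_mono[OF less_imp_le[OF N[OF that]], of "\<bar>f n\<bar>"] by (simp add: abs_mult)
    qed
  qed simp
  moreover have "kummer_M x y z = suminf f"
    by (simp add: kummer_M_def f_def kummer_coeff_def)
  ultimately show ?thesis by (simp add: f_def summable_sums)
qed

lemma sums_shift_power: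
  fixes z :: real
  assumes "(\<lambda>n. a n * z ^ n) sums s"
  shows "(\<lambda>n. (case n of 0 \<Rightarrow> 0 | Suc m \<Rightarrow> a m) * z ^ n) sums (z * s)"
proof -
  have "(\<lambda>n. z * (a n * z ^ n)) sums (z * s)" by (rule sums_mult[OF assms])
  then show ?thesis using sums_Suc_iff[of "\<lambda>n. (case n of 0 \<Rightarrow> 0 | Suc m \<Rightarrow> a m) * z ^ n" "z * s"]
    by (simp add: mult.left_commute)
qed

lemma kummer_M_0: "y \<notin> \<int> \<Longrightarrow> kummer_M x y 0 = 1"
  using sums_unique2[OF kummer_sums[of y x 0] powser_sums_zero] by simp

lemma Ints_plus1_iff: "(y::real) + 1 \<in> \<int> \<longleftrightarrow> y \<in> \<int>"
  by (metis Ints_1 Ints_add Ints_diff add_diff_cancel_right')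

lemma has_field_derivative_kummer_M:
  assumes "y \<notin> \<int>"
  shows "(kummer_M x y has_field_derivative x / y * kummer_M (x + 1) (y + 1) z) (at z)"
proof -
  have y1: "y + 1 \<notin> \<int>" using assms by (simp add: Ints_plus1_iff)
  have "((\<lambda>z. \<Sum>n. kummer_coeff x y n * z ^ n) has_field_derivative
      (\<Sum>n. diffs (kummer_coeff x y) n * z ^ n)) (at z)"
    by (rule termdiffs_strong_converges_everywhere) (rule sums_summable[OF kummer_sums[OF assms]])
  moreover have "(\<lambda>z. \<Sum>n. kummer_coeff x y n * z ^ n) = kummer_M x y"
    using kummer_sums[OF assms] by (auto simp: sums_iff)
  moreover have "diffs (kummer_coeff x y) n = x / y * kummer_coeff (x + 1) (y + 1) n" for n
    by (simp add: diffs_def kummer_coeff_Suc' del: of_nat_Suc)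
  then have "(\<Sum>n. diffs (kummer_coeff x y) n * z ^ n) = x / y * kummer_M (x + 1) (y + 1) z"
    using sums_mult[OF kummer_sums[OF y1, of "x + 1" z], of "x / y"]
    by (simp add: sums_iff mult_ac)
  ultimately show ?thesis by simp
qed

text \<open>Comparison of coefficients: the right-hand side collapses to
  \<open>(y + n) * kummer_coeff x (y + 1) n\<close>, which is
  \<open>y * kummer_coeff x y n\<close>.\<close>

lemma kummer_contiguous1:
  assumes "y \<notin> \<int>"
  shows "y * kummer_M x y z = x * kummer_M (x + 1) (y + 1) z - (x - y) * kummer_M x (y + 1) z"
proof -
  have y1: "y + 1 \<notin> \<int>" using assms by (simp add: Ints_plus1_iff)
  have "(\<lambda>n. x * (kummer_coeff (x + 1) (y + 1) n * z ^ n) - (x - y) * (kummer_coeff x (y + 1) n * z ^ n))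
      sums (x * kummer_M (x + 1) (y + 1) z - (x - y) * kummer_M x (y + 1) z)"
    using y1 by (intro sums_diff sums_mult kummer_sums)
  moreover have "x * (kummer_coeff (x + 1) (y + 1) n * z ^ n) - (x - y) * (kummer_coeff x (y + 1) n * z ^ n)
      = y * (kummer_coeff x y n * z ^ n)" for n
  proof -
    have "x * (kummer_coeff (x + 1) (y + 1) n) - (x - y) * (kummer_coeff x (y + 1) n)
       = (y + n) * kummer_coeff x (y + 1) n"
      using kummer_coeff_plus1_left[of x "y + 1" n] by (simp add: algebra_simps)
    also have "\<dots> = y * kummer_coeff x y n"
      using nonint_add_of_nat_neq_0[OF assms] by (simp add: kummer_coeff_plus1_right[OF assms])
    finally have eq: "x * kummer_coeff (x + 1) (y + 1) n - (x - y) * kummer_coeff x (y + 1) n = y * kummer_coeff x y n" .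
    have "x * (kummer_coeff (x + 1) (y + 1) n * z ^ n) - (x - y) * (kummer_coeff x (y + 1) n * z ^ n)
        = (x * kummer_coeff (x + 1) (y + 1) n - (x - y) * kummer_coeff x (y + 1) n) * z ^ n"
      by (simp only: left_diff_distrib mult.assoc)
    then show ?thesis unfolding eq by simp
  qed
  ultimately show ?thesis
    using sums_mult[OF kummer_sums[OF assms, of x z], of y] sums_unique2 by fastforce
qed

text \<open>Comparison of coefficients again; the factor \<open>z\<close> shifts the left-hand
  series by one, so its coefficient \<open>m\<close> meets coefficient \<open>Suc m\<close> on the
  right, and both constant terms on the right cancel.\<close>

lemma kummer_contiguous2:
  assumes "y \<notin> \<int>"
  shows "z * kummer_M (s + 1) (y + 1) z = y * (kummer_M (s + 1) y z - kummer_M s y z)"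
proof -
  have y1: "y + 1 \<notin> \<int>" using assms by (simp add: Ints_plus1_iff)
  have y0: "y \<noteq> 0" using assms by auto
  have *: "(case n of 0 \<Rightarrow> 0 | Suc m \<Rightarrow> kummer_coeff (s + 1) (y + 1) m) * z ^ n =
        y * (kummer_coeff (s + 1) y n * z ^ n - kummer_coeff s y n * z ^ n)" for n
  proof (cases n)
    case (Suc m)
    have "(s + 1) * kummer_coeff (s + 1 + 1) (y + 1) m = (s + 1 + m) * kummer_coeff (s + 1) (y + 1) m"
      by (rule kummer_coeff_plus1_left)
    then have "kummer_coeff (s + 1) (y + 1) m * (m + 1)
        = (s + 1) * kummer_coeff (s + 1 + 1) (y + 1) m - s * kummer_coeff (s + 1) (y + 1) m"
      by (simp add: algebra_simps)
    also have "\<dots> = y * (kummer_coeff (s + 1) y (Suc m) - kummer_coeff s y (Suc m)) * (m + 1)"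
      using y0 by (simp add: kummer_coeff_Suc' right_diff_distrib left_diff_distrib)
    finally have eq: "kummer_coeff (s + 1) (y + 1) m =
        y * (kummer_coeff (s + 1) y (Suc m) - kummer_coeff s y (Suc m))" by simp
    show ?thesis unfolding Suc nat.case eq
      by (simp only: left_diff_distrib right_diff_distrib mult.assoc)
  qed auto
  have "(\<lambda>n. y * (kummer_coeff (s + 1) y n * z ^ n - kummer_coeff s y n * z ^ n))
    sums (y * (kummer_M (s + 1) y z - kummer_M s y z))"
    using assms by (intro sums_diff sums_mult kummer_sums)
  then show ?thesis
    using sums_shift_power[OF kummer_sums[OF y1, of "s + 1" z]] sums_unique2 unfolding * by blast
qed

text \<open>The derivatives of \<open>kummer_M x y\<close> are multiples of functions with both
  parameters raised, so Kummer's equation becomes a consequence of four contiguous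
  relations.\<close>

lemma kummer_ode:
  assumes "y \<notin> \<int>"
  shows "z * (x / y * ((x + 1) / (y + 1) * kummer_M (x + 2) (y + 2) z))
    + (y - z) * (x / y * kummer_M (x + 1) (y + 1) z) - x * kummer_M x y z = 0"
proof -
  have y1: "y + 1 \<notin> \<int>" using assms by (simp add: Ints_plus1_iff)
  have y0: "y \<noteq> 0" "y + 1 \<noteq> 0" using assms y1 by (metis Ints_0)+
  have c1: "y * kummer_M x y z = x * kummer_M (x + 1) (y + 1) z - (x - y) * kummer_M x (y + 1) z"
    by (rule kummer_contiguous1[OF assms])
  have c2: "z * kummer_M (x + 2) (y + 2) z = (y + 1) * (kummer_M (x + 2) (y + 1) z - kummer_M (x + 1) (y + 1) z)"
    using kummer_contiguous2[OF y1, of z "x + 1"] by (simp add: add.assoc)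
  have c3: "z * kummer_M (x + 1) (y + 1) z = y * (kummer_M (x + 1) y z - kummer_M x y z)"
    by (rule kummer_contiguous2[OF assms])
  have c4: "y * kummer_M (x + 1) y z = (x + 1) * kummer_M (x + 2) (y + 1) z - (x + 1 - y) * kummer_M (x + 1) (y + 1) z"
    using kummer_contiguous1[OF assms, of "x + 1" z] by (simp add: add.assoc)
  \<comment> \<open>The equation with its common factor \<open>x / y\<close> removed; the factor is
    restored by multiplication, so nothing is ever divided by \<open>x\<close>.\<close>
  have "(x + 1) / (y + 1) * (z * kummer_M (x + 2) (y + 2) z) + y * kummer_M (x + 1) (y + 1) z
     - z * kummer_M (x + 1) (y + 1) z - y * kummer_M x y z = 0"
    using c3 c4 y0 by (simp add: c2) (simp add: algebra_simps)
  then have "x / y * ((x + 1) / (y + 1) * (z * kummer_M (x + 2) (y + 2) z) + y * kummer_M (x + 1) (y + 1) z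
     - z * kummer_M (x + 1) (y + 1) z - y * kummer_M x y z) = 0" by simp
  then show ?thesis using y0 by (simp add: diff_divide_distrib algebra_simps)
qed

subsection \<open>Integral representation of the Tricomi function\<close>

text \<open>Abel's identity: the Wronskian of two solutions satisfies
  \<open>W' = (1 - y / z) * W\<close>, hence is a constant times
  \<open>z powr (- y) * exp z\<close>. The constant is found from the limit at \<open>0\<close>,
  where the exponential factor tends to \<open>1\<close>.\<close>

lemma kummer_wronskian:
  fixes f g :: "real \<Rightarrow> real"
  assumes df: "\<And>z. z > 0 \<Longrightarrow> (f has_field_derivative f1 z) (at z)"
             "\<And>z. z > 0 \<Longrightarrow> (f1 has_field_derivative f2 z) (at z)"
    and dg: "\<And>z. z > 0 \<Longrightarrow> (g has_field_derivative g1 z) (at z)"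
             "\<And>z. z > 0 \<Longrightarrow> (g1 has_field_derivative g2 z) (at z)"
    and odef: "\<And>z. z > 0 \<Longrightarrow> z * f2 z + (y - z) * f1 z - x * f z = 0"
    and odeg: "\<And>z. z > 0 \<Longrightarrow> z * g2 z + (y - z) * g1 z - x * g z = 0"
    and lim: "((\<lambda>z. z powr y * (f z * g1 z - f1 z * g z)) \<longlongrightarrow> c) (at_right 0)"
    and z: "z > 0"
  shows "z powr y * exp (- z) * (f z * g1 z - f1 z * g z) = c"
proof -
  define W where "W = (\<lambda>z. z powr y * exp (- z) * (f z * g1 z - f1 z * g z))"
  have "(W has_field_derivative 0) (at z)" if z: "z > 0" for z
  proof -
    have "(W has_field_derivative z powr y * exp (- z) * ((y / z - 1) * (f z * g1 z - f1 z * g z) + (f z * g2 z - f2 z * g z))) (at z)"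
      unfolding W_def using z
      by (auto intro!: derivative_eq_intros df dg simp: powr_diff) (simp add: field_simps)
    moreover have "z * ((y / z - 1) * (f z * g1 z - f1 z * g z) + (f z * g2 z - f2 z * g z)) = 0"
    proof -
      \<comment> \<open>\<open>g\<close> times the equation of \<open>f\<close> is subtracted from
        \<open>f\<close> times the equation of \<open>g\<close>; the terms with \<open>x\<close>
        cancel.\<close>
      have "f z * (z * g2 z) - g z * (z * f2 z) = - ((y - z) * (f z * g1 z - f1 z * g z))"
        using odef[OF z] odeg[OF z]
        by (simp add: algebra_simps add_eq_0_iff2 eq_neg_iff_add_eq_0) (algebra)
      then show ?thesis using z by (simp add: field_simps)
    qed
    then have "(y / z - 1) * (f z * g1 z - f1 z * g z) + (f z * g2 z - f2 z * g z) = 0"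
      using z by simp
    ultimately show ?thesis by simp
  qed
  then obtain d where d: "\<And>z. z > 0 \<Longrightarrow> W z = d"
    using has_field_derivative_zero_constant[of "{0<..}" W] by (auto intro: has_field_derivative_at_within)
  have "((\<lambda>z. exp (- z) * (z powr y * (f z * g1 z - f1 z * g z))) \<longlongrightarrow> exp (- 0) * c) (at_right 0)"
    by (intro tendsto_intros lim)
  then have "(W \<longlongrightarrow> c) (at_right 0)"
    by (simp add: W_def mult_ac)
  moreover have "(W \<longlongrightarrow> d) (at_right 0)"
    using eventually_at_right_less[of 0] by (intro tendsto_eventually) (auto elim!: eventually_mono simp: d)
  ultimately have "c = d" by (intro tendsto_unique) auto
  then show ?thesis using d[OF z] by (simp add: W_def)
qed

lemma tendsto_kummer_M:
  assumes "y \<notin> \<int>" shows "(kummer_M x y \<longlongrightarrow> 1) (at_right 0)"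
proof -
  have "(kummer_M x y \<longlongrightarrow> kummer_M x y 0) (at 0)"
    using DERIV_isCont[OF has_field_derivative_kummer_M[OF assms]] by (simp add: isCont_def)
  then show ?thesis using assms by (auto simp: kummer_M_0 intro: tendsto_within_subset)
qed

text \<open>At integers both sides are \<open>0\<close> by the conventions for poles of Gamma and
  for division by \<open>0\<close>.\<close>

lemma Gamma_reflection_real: "Gamma x * Gamma (1 - x) = pi / sin (pi * (x::real))"
proof -
  have "complex_of_real (Gamma x) * complex_of_real (Gamma (1 - x)) = of_real pi / complex_of_real (sin (pi * x))"
    using Gamma_reflection_complex[of "complex_of_real x"]
    by (metis Gamma_complex_of_real of_real_1 of_real_diff of_real_mult sin_of_real)
  then show ?thesis by (metis of_real_divide of_real_eq_iff of_real_mult)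
qed

lemma Gamma_plus1_pos: "(x::real) > 0 \<Longrightarrow> Gamma (x + 1) = x * Gamma x"
  by (intro Gamma_plus1) (auto elim!: nonpos_Ints_cases)

text \<open>The integral is expanded in the two Kummer solutions, with coefficients obtained from
  three Wronskians. For \<open>0 < y < 1\<close> the integral has a finite limit at
  \<open>0\<close>, while its derivative is of order \<open>z powr (- y)\<close>, so every Wronskian
  limit can be computed.\<close>

lemma tricomi_nonint_integral_strip:
  assumes x: "x > 0" and y: "0 < y" "y < 1" and z: "z > 0"
  shows "laplace_integral x (y - x - 1) z = Gamma x * tricomi_nonint x y z"
proof -
  \<comment> \<open>The kernel exponent is \<open>- s\<close>. The same \<open>s\<close>, together
    with \<open>y' = 2 - y\<close>, gives the parameters of the second Kummer solution
    \<open>U\<close>.\<close>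
  define s where "s = 1 + x - y"
  define I I1 I2 where "I = laplace_integral x (- s)" and "I1 = (\<lambda>z. - laplace_integral (x + 1) (- s) z)" and "I2 = laplace_integral (x + 2) (- s)"
  define M M1 M2 where "M = kummer_M x y" and "M1 = (\<lambda>z. x / y * kummer_M (x + 1) (y + 1) z)"
    and "M2 = (\<lambda>z. x / y * ((x + 1) / (y + 1) * kummer_M (x + 2) (y + 2) z))"
  define y' where "y' = 2 - y"
  define N N1 N2 where "N = kummer_M s y'" and "N1 = (\<lambda>z. s / y' * kummer_M (s + 1) (y' + 1) z)"
    and "N2 = (\<lambda>z. s / y' * ((s + 1) / (y' + 1) * kummer_M (s + 2) (y' + 2) z))"
  define U U1 U2 where "U = (\<lambda>z. z powr (1 - y) * N z)"
    and "U1 = (\<lambda>z. (1 - y) * z powr (- y) * N z + z powr (1 - y) * N1 z)"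
    and "U2 = (\<lambda>z. - y * (1 - y) * z powr (- y - 1) * N z + 2 * (1 - y) * z powr (- y) * N1 z + z powr (1 - y) * N2 z)"
  define L where "L = Beta x (1 - y)"
  have s: "s > 0" "x - s = y - 1" using x y by (auto simp: s_def)
  have yZ: "y \<notin> \<int>"
  proof
    assume "y \<in> \<int>"
    then obtain k :: int where "y = of_int k" by (elim Ints_cases)
    then have "0 < k" "k < 1" using y by simp_all
    then show False by simp
  qed
  have y1Z: "y + 1 \<notin> \<int>" using yZ by (simp add: Ints_plus1_iff)
  have y'Z: "y' \<notin> \<int>"
  proof
    assume "y' \<in> \<int>"
    then have "2 - y' \<in> \<int>" by (intro Ints_diff) auto
    then show False using yZ by (simp add: y'_def)
  qed
  have y'1Z: "y' + 1 \<notin> \<int>" using y'Z by (simp add: Ints_plus1_iff)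

  have dI: "(I has_field_derivative I1 z) (at z)" "(I1 has_field_derivative I2 z) (at z)" if "z > 0" for z
    using has_field_derivative_laplace_integral[of x z "- s"] DERIV_minus[OF has_field_derivative_laplace_integral[of "x + 1" z "- s"]] x that
    by (simp_all add: I_def I1_def I2_def add.assoc)
  have dM: "(M has_field_derivative M1 z) (at z)" "(M1 has_field_derivative M2 z) (at z)" for z
    using has_field_derivative_kummer_M[OF yZ, of x z]
      DERIV_cmult[OF has_field_derivative_kummer_M[OF y1Z, of "x + 1" z], of "x / y"]
    by (simp_all add: M_def M1_def M2_def add.assoc)
  have dN: "(N has_field_derivative N1 z) (at z)" "(N1 has_field_derivative N2 z) (at z)" for z
    using has_field_derivative_kummer_M[OF y'Z, of s z]
      DERIV_cmult[OF has_field_derivative_kummer_M[OF y'1Z, of "s + 1" z], of "s / y'"]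
    by (simp_all add: N_def N1_def N2_def add.assoc)
  have dU: "(U has_field_derivative U1 z) (at z)" "(U1 has_field_derivative U2 z) (at z)" if "z > 0" for z
    using that unfolding U_def U1_def U2_def
    by (auto intro!: derivative_eq_intros dN simp: algebra_simps)

  have odeI: "z * I2 z + (y - z) * I1 z - x * I z = 0" if "z > 0" for z
    using laplace_integral_ode[OF x that, of "- s"] s by (simp add: I_def I1_def I2_def s_def)
  have odeM: "z * M2 z + (y - z) * M1 z - x * M z = 0" for z
    using kummer_ode[OF yZ] by (simp add: M_def M1_def M2_def)
  \<comment> \<open>Substituting \<open>U\<close> and factoring out \<open>z powr (1 - y)\<close>
    leaves Kummer's equation with parameters \<open>s\<close> and \<open>y'\<close>, which
    \<open>N\<close> satisfies.\<close>
  have odeU: "z * U2 z + (y - z) * U1 z - x * U z = 0" if z: "z > 0" for z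
  proof -
    have "z * N2 z + (y' - z) * N1 z - s * N z = 0"
      using kummer_ode[OF y'Z] by (simp add: N_def N1_def N2_def)
    moreover have pz: "z powr (- y) = z * z powr (- y - 1)" "z powr (1 - y) = z * (z * z powr (- y - 1))"
      using z by (simp_all add: powr_diff powr_minus field_simps)
    have "z * U2 z + (y - z) * U1 z - x * U z
       = z powr (1 - y) * (z * N2 z + (y' - z) * N1 z - s * N z)"
      unfolding U_def U1_def U2_def y'_def s_def pz by (simp add: algebra_simps)
    ultimately show ?thesis by simp
  qed

  have limI: "(I \<longlongrightarrow> L) (at_right 0)"
    using laplace_integral_at_0[of x "- s"] x y s by (simp add: I_def L_def)
  \<comment> \<open>The derivative is a negative integral with exponents \<open>x + 1\<close> and
    \<open>- s\<close>, whose sum \<open>y\<close> is positive: the singular case.\<close>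
  have limI1: "((\<lambda>z. z powr y * I1 z) \<longlongrightarrow> - Gamma y) (at_right 0)"
    using tendsto_minus[OF laplace_integral_at_0_singular[of "x + 1" "- s"]] x y s by (simp add: I1_def s_def)
  have limM: "(M \<longlongrightarrow> 1) (at_right 0)" "(M1 \<longlongrightarrow> x / y * 1) (at_right 0)"
    unfolding M_def M1_def by (intro tendsto_mult_left tendsto_kummer_M yZ y1Z)+
  have limN: "(N \<longlongrightarrow> 1) (at_right 0)" "(N1 \<longlongrightarrow> s / y' * 1) (at_right 0)"
    unfolding N_def N1_def by (intro tendsto_mult_left tendsto_kummer_M y'Z y'1Z)+
  have limz: "((\<lambda>z. z powr a) \<longlongrightarrow> 0) (at_right 0)" if "a > 0" for a :: real
  proof -
    have "((\<lambda>z. z powr a) \<longlongrightarrow> 0 powr a) (at_right 0)"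
      using that by (intro tendsto_intros) (auto intro: eventually_at_right_less[THEN eventually_mono])
    then show ?thesis using that by simp
  qed
  have limU: "(U \<longlongrightarrow> 0 * 1) (at_right 0)"
    unfolding U_def using y by (intro tendsto_mult limz limN) auto
  have limU1: "((\<lambda>z. z powr y * U1 z) \<longlongrightarrow> 1 - y) (at_right 0)"
  proof -
    have "((\<lambda>z. (1 - y) * N z + z * N1 z) \<longlongrightarrow> (1 - y) * 1 + 0 * (s / y' * 1)) (at_right 0)"
      by (intro tendsto_intros limN)
    moreover have "\<forall>\<^sub>F z in at_right 0. (1 - y) * N z + z * N1 z = z powr y * U1 z"
      using eventually_at_right_less[of 0]
      by eventually_elim (simp add: U1_def powr_minus powr_diff field_simps)
    ultimately show ?thesis by (auto intro: Lim_transform_eventually)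
  qed

  \<comment> \<open>In the limit only \<open>- I1 * M\<close> contributes, because
    \<open>I * M1\<close> stays bounded and \<open>z powr y\<close> tends to
    \<open>0\<close>.\<close>
  have "z powr y * exp (- z) * (I z * M1 z - I1 z * M z) = Gamma y"
  proof (rule kummer_wronskian[OF dI dM odeI odeM _ z])
    have "((\<lambda>z. z powr y * (I z * M1 z) - (z powr y * I1 z) * M z) \<longlongrightarrow> 0 * (L * (x / y * 1)) - (- Gamma y) * 1) (at_right 0)"
      using y by (intro tendsto_intros limI limI1 limM limz)
    then show "((\<lambda>z. z powr y * (I z * M1 z - I1 z * M z)) \<longlongrightarrow> Gamma y) (at_right 0)"
      by (simp add: algebra_simps)
  qed auto
  moreover have "z powr y * exp (- z) * (I z * U1 z - I1 z * U z) = (1 - y) * L"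
  proof (rule kummer_wronskian[OF dI dU odeI odeU _ z])
    have "((\<lambda>z. I z * (z powr y * U1 z) - (z powr y * I1 z) * U z) \<longlongrightarrow> L * (1 - y) - (- Gamma y) * (0 * 1)) (at_right 0)"
      by (intro tendsto_intros limI limI1 limU limU1)
    then show "((\<lambda>z. z powr y * (I z * U1 z - I1 z * U z)) \<longlongrightarrow> (1 - y) * L) (at_right 0)"
      by (simp add: algebra_simps)
  qed auto
  moreover have "z powr y * exp (- z) * (M z * U1 z - M1 z * U z) = 1 - y"
  proof (rule kummer_wronskian[OF dM dU odeM odeU _ z])
    have "((\<lambda>z. M z * (z powr y * U1 z) - z powr y * (M1 z * U z)) \<longlongrightarrow> 1 * (1 - y) - 0 * (x / y * 1 * (0 * 1))) (at_right 0)"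
      using y by (intro tendsto_intros limM limU limU1 limz)
    then show "((\<lambda>z. z powr y * (M z * U1 z - M1 z * U z)) \<longlongrightarrow> 1 - y) (at_right 0)"
      by (simp add: algebra_simps)
  qed auto
  moreover define k where "k = z powr y * exp (- z)"
  \<comment> \<open>Cramer's rule: a determinant with the two equal rows \<open>I, M, U\<close> and
    the row \<open>I1, M1, U1\<close> vanishes.\<close>
  have "I z * (k * (M z * U1 z - M1 z * U z)) = M z * (k * (I z * U1 z - I1 z * U z)) - U z * (k * (I z * M1 z - I1 z * M z))"
    by (simp add: algebra_simps)
  ultimately have "I z * (1 - y) = M z * ((1 - y) * L) - U z * Gamma y"
    unfolding k_def by simp
  then have "I z = L * M z - Gamma y / (1 - y) * U z"
    using y by (simp add: field_simps)
  moreover have "Gamma x * tricomi_nonint x y z = L * M z - Gamma y / (1 - y) * U z"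
  proof -
    have G: "Gamma x > 0" "Gamma y > 0" "Gamma s > 0" "Gamma (1 - y) > 0"
      using x y s by auto
    have "Gamma (1 - y + 1) = (1 - y) * Gamma (1 - y)"
      using y by (intro Gamma_plus1_pos) auto
    then have G2: "Gamma (2 - y) = (1 - y) * Gamma (1 - y)" by (simp add: algebra_simps)
    have L: "L = Gamma x * Gamma (1 - y) / Gamma s" by (simp add: L_def Beta_def s_def algebra_simps)
    have "Gamma x * tricomi_nonint x y z =
       Gamma x * (Gamma y * Gamma (1 - y) * (M z / (Gamma s * Gamma y) - U z / (Gamma x * Gamma (2 - y))))"
      by (simp add: tricomi_nonint_def Gamma_reflection_real M_def U_def N_def s_def y'_def)
    also have "\<dots> = L * M z - Gamma y / (1 - y) * U z"
    proof -
      \<comment> \<open>The Gamma values are abstracted to nonzero reals. \<open>gy * g1\<close> is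
        the prefactor \<open>pi / sin (pi * y)\<close> by reflection, and \<open>d * g1\<close> is
        \<open>Gamma (2 - y)\<close>.\<close>
      have "gx * (gy * g1 * (m / (gs * gy) - u / (gx * (d * g1)))) = gx * g1 / gs * m - gy / d * u"
        if "gx \<noteq> 0" "gy \<noteq> 0" "gs \<noteq> 0" "g1 \<noteq> 0" "d \<noteq> 0" for gx gy gs g1 d m u :: real
        using that by (simp add: field_simps)
      moreover have "Gamma x \<noteq> 0" "Gamma y \<noteq> 0" "Gamma s \<noteq> 0" "Gamma (1 - y) \<noteq> 0"
        using G by linarith+
      ultimately show ?thesis unfolding L G2 using y by simp
    qed
    finally show ?thesis .
  qed
  moreover have "- s = y - x - 1" by (simp add: s_def)
  ultimately show ?thesis by (simp add: I_def)
qed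

section \<open>Extension of the representation to all non-integer second parameters\<close>

text \<open>Moves the second parameter one unit to the left. The two Kummer terms are treated
  separately, by \<open>kummer_contiguous1\<close> and \<open>kummer_contiguous2\<close>; the sine
  changes sign, and the Gamma recurrence adjusts the denominators.\<close>

lemma tricomi_nonint_descent:
  assumes yZ: "y \<notin> \<int>" and z: "z > 0" and x: "x > 0" and s: "1 + x - y > 0"
  shows "tricomi_nonint x (y - 1) z = tricomi_nonint x y z - x * tricomi_nonint (x + 1) y z"
proof -
  define A where "A = pi / sin (pi * y)"
  define s where "s = 1 + x - y"
  have s0: "s > 0" using assms by (simp add: s_def)
  have Gs: "Gamma (1 + s) = s * Gamma s" "Gamma s > 0"
    using Gamma_plus1_pos[of s] s0 by (auto simp: add_ac)
  have Gx: "Gamma (x + 1) = x * Gamma x" "Gamma x > 0"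
    using Gamma_plus1_pos[of x] x by auto
  have y1Z: "y - 1 \<notin> \<int>" using yZ Ints_plus1_iff[of "y - 1"] by simp
  have y2Z: "2 - y \<notin> \<int>"
  proof
    assume "2 - y \<in> \<int>"
    then have "2 - (2 - y) \<in> \<int>" by (intro Ints_diff) auto
    then show False using yZ by simp
  qed
  have yn: "y - 1 \<noteq> 0" "2 - y \<noteq> 0" using y1Z y2Z by (metis Ints_0)+
  have nonpos: "y - 1 \<notin> \<int>\<^sub>\<le>\<^sub>0" "2 - y \<notin> \<int>\<^sub>\<le>\<^sub>0"
    using y1Z y2Z nonpos_Ints_subset_Ints by blast+
  have Gy: "Gamma y = (y - 1) * Gamma (y - 1)" "Gamma (y - 1) \<noteq> 0"
    using Gamma_plus1[OF nonpos(1)] nonpos by (auto simp: Gamma_eq_zero_iff)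
  have G2: "Gamma (3 - y) = (2 - y) * Gamma (2 - y)" "Gamma (2 - y) \<noteq> 0"
    using Gamma_plus1[OF nonpos(2)] nonpos by (auto simp: Gamma_eq_zero_iff)
  have c1: "(y - 1) * kummer_M x (y - 1) z = x * kummer_M (x + 1) y z - s * kummer_M x y z"
    using kummer_contiguous1[OF y1Z, of x z] by (simp add: s_def algebra_simps)
  have c2: "z * kummer_M (s + 1) (3 - y) z = (2 - y) * (kummer_M (s + 1) (2 - y) z - kummer_M s (2 - y) z)"
    using kummer_contiguous2[OF y2Z, of z s] by simp
  have sn: "sin (pi * (y - 1)) = - sin (pi * y)" by (simp add: right_diff_distrib)
  have pz: "z powr (2 - y) = z powr (1 - y) * z" using z by (simp add: powr_diff power2_eq_square)
  have a1: "kummer_M x (y - 1) z / (Gamma (1 + s) * Gamma (y - 1))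
     = x * kummer_M (x + 1) y z / (Gamma (1 + s) * Gamma y) - kummer_M x y z / (Gamma s * Gamma y)"
  proof -
    have "kummer_M x (y - 1) z / (Gamma (1 + s) * Gamma (y - 1))
      = (y - 1) * kummer_M x (y - 1) z / (Gamma (1 + s) * Gamma y)"
      using yn Gy by simp
    also have "\<dots> = x * kummer_M (x + 1) y z / (Gamma (1 + s) * Gamma y) - s * kummer_M x y z / (Gamma (1 + s) * Gamma y)"
      unfolding c1 by (simp add: diff_divide_distrib)
    finally show ?thesis using Gs s0 by simp
  qed
  have a2: "z * kummer_M (s + 1) (3 - y) z / (Gamma x * Gamma (3 - y))
     = kummer_M (s + 1) (2 - y) z / (Gamma x * Gamma (2 - y)) - kummer_M s (2 - y) z / (Gamma x * Gamma (2 - y))"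
    unfolding c2 G2 using yn by (simp add: diff_divide_distrib)
  have "tricomi_nonint x (y - 1) z
     = - A * (kummer_M x (y - 1) z / (Gamma (1 + s) * Gamma (y - 1))
        - z powr (1 - y) * (z * kummer_M (s + 1) (3 - y) z / (Gamma x * Gamma (3 - y))))"
    unfolding tricomi_nonint_def sn A_def by (simp add: pz s_def algebra_simps)
  also have "\<dots> = A * (kummer_M x y z / (Gamma s * Gamma y) - z powr (1 - y) * (kummer_M s (2 - y) z / (Gamma x * Gamma (2 - y))))
     - x * (A * (kummer_M (x + 1) y z / (Gamma (1 + s) * Gamma y)
          - z powr (1 - y) * (kummer_M (s + 1) (2 - y) z / (Gamma (x + 1) * Gamma (2 - y)))))"
    unfolding a1 a2 Gx using x by (simp add: algebra_simps)
  also have "\<dots> = tricomi_nonint x y z - x * tricomi_nonint (x + 1) y z"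
    unfolding tricomi_nonint_def by (simp add: A_def s_def algebra_simps)
  finally show ?thesis .
qed

text \<open>Induction on the number of unit steps from the strip \<open>0 < t < 1\<close>, with
  \<open>x\<close> arbitrary because the descent also calls \<open>x + 1\<close>. In each step the
  descent is matched by \<open>laplace_integral_split\<close>.\<close>

lemma tricomi_nonint_integral_lt_1:
  assumes "x > 0" "y < 1" "y \<notin> \<int>" "z > 0"
  shows "tricomi_nonint x y z = laplace_integral x (y - x - 1) z / Gamma x"
proof -
  \<comment> \<open>As the floor of \<open>y\<close> is at most \<open>0\<close>,
    \<open>y + real n\<close> is the fractional part of \<open>y\<close>, which is positive for
    non-integer \<open>y\<close>.\<close>
  define n where "n = nat (- \<lfloor>y\<rfloor>)"
  have "tricomi_nonint x (t - real n) z = laplace_integral x (t - real n - x - 1) z / Gamma x"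
    if "0 < t" "t < 1" "x > 0" for t x n
    using that
  proof (induction n arbitrary: x)
    case 0
    then have "Gamma x \<noteq> 0" using Gamma_real_pos[of x] by linarith
    then show ?case using tricomi_nonint_integral_strip[of x t z] assms(4) 0 by simp
  next
    case (Suc n)
    have tZ: "t - real n \<notin> \<int>"
    proof
      assume "t - real n \<in> \<int>"
      then have "t - real n + real n \<in> \<int>" by (intro Ints_add) auto
      then obtain k :: int where "t = of_int k" by (auto elim: Ints_cases)
      then have "0 < k" "k < 1" using Suc.prems by simp_all
      then show False by simp
    qed
    have Gx: "Gamma (x + 1) = x * Gamma x" "Gamma x > 0"
      using Gamma_plus1_pos[of x] Suc.prems by auto
    have "tricomi_nonint x (t - real (Suc n)) z = tricomi_nonint x (t - real n - 1) z"
      by (simp add: algebra_simps)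
    also have "\<dots> = tricomi_nonint x (t - real n) z - x * tricomi_nonint (x + 1) (t - real n) z"
      using Suc.prems assms by (intro tricomi_nonint_descent tZ) auto
    also have "\<dots> = (laplace_integral x (t - real n - x - 1) z - laplace_integral (x + 1) (t - real n - x - 2) z) / Gamma x"
      using Suc.IH[of x] Suc.IH[of "x + 1"] Suc.prems Gx by (simp add: diff_divide_distrib algebra_simps)
    also have "\<dots> = laplace_integral x (t - real n - x - 2) z / Gamma x"
      using laplace_integral_split[of x z "t - real n - x - 2"] Suc.prems assms by (simp add: algebra_simps)
    finally show ?case by (simp add: algebra_simps)
  qed
  moreover have "0 < y + real n" "y + real n < 1"
  proof -
    have "y \<noteq> of_int \<lfloor>y\<rfloor>" using assms(3) by (metis Ints_of_int)
    moreover have "\<lfloor>y\<rfloor> \<le> 0" using assms(2) by (simp add: floor_le_iff)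
    ultimately show "0 < y + real n" "y + real n < 1" unfolding n_def by linarith+
  qed
  ultimately show ?thesis using assms by (metis add_diff_cancel_right')
qed

text \<open>Kummer's transformation: the two terms of the defining formula exchange roles, and the
  sign of the sine makes up for their reversed order.\<close>

lemma tricomi_nonint_symmetry:
  assumes "z > 0"
  shows "tricomi_nonint x y z = z powr (1 - y) * tricomi_nonint (1 + x - y) (2 - y) z"
proof -
  have "sin (pi * (2 - y)) = - sin (pi * y)"
    by (simp add: right_diff_distrib sin_diff)
  moreover have "z powr (1 - y) * z powr (y - 1) = 1"
    using assms by (simp flip: powr_add)
  ultimately show ?thesis
    by (simp add: tricomi_nonint_def algebra_simps)
qed

lemma tricomi_nonint_integral_gt_1:
  assumes "1 + x - y > 0" "y > 1" "y \<notin> \<int>" "z > 0"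
  shows "tricomi_nonint x y z = z powr (1 - y) * (laplace_integral (1 + x - y) (- x) z / Gamma (1 + x - y))"
proof -
  have "2 - y \<notin> \<int>"
  proof
    assume "2 - y \<in> \<int>"
    then have "2 - (2 - y) \<in> \<int>" by (intro Ints_diff) auto
    then show False using assms by simp
  qed
  then show ?thesis
    using tricomi_nonint_symmetry[OF assms(4), of x y] tricomi_nonint_integral_lt_1[of "1 + x - y" "2 - y" z] assms by simp
qed

text \<open>Every set of integers is closed, so the complement of the integers other than
  \<open>y\<close> is an open neighbourhood of \<open>y\<close>.\<close>

lemma eventually_nonint: "\<forall>\<^sub>F t in at y. (t::real) \<notin> \<int>"
proof -
  have "open (- (\<int> - {y}))"
    by (intro open_Compl closed_subset_Ints) auto
  then have "\<forall>\<^sub>F t in at y. t \<in> - (\<int> - {y}) - {y}"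
    by (rule eventually_at_in_open) auto
  then show ?thesis
    by eventually_elim auto
qed

subsection \<open>Asymptotics\<close>

text \<open>At an integer \<open>y\<close> the two one-sided limits are computed from the
  representations at nearby non-integers. For \<open>y = 1\<close> the right-hand side uses the form
  for \<open>t > 1\<close>; both forms agree at \<open>1\<close>, where the prefactor
  \<open>z powr (1 - t)\<close> becomes \<open>1\<close>.\<close>

lemma tricomi_pos_le_1:
  assumes x: "x > 0" and y: "y \<le> 1" and z: "z > 0"
  shows "tricomi_pos x y z = laplace_integral x (y - x - 1) z / Gamma x"
proof (cases "y \<in> \<int>")
  case False
  then have "y < 1" using y by (cases "y = 1") auto
  then show ?thesis using tricomi_nonint_integral_lt_1[OF x _ False z] False by (simp add: tricomi_pos_def)
next
  case True
  have Gx: "Gamma x \<noteq> 0" using Gamma_real_pos[OF x] by linarith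
  define F where "F = (\<lambda>t. laplace_integral x (t - x - 1) z / Gamma x)"
  have lim: "(F \<longlongrightarrow> F y) (at y within A)" for A
    unfolding F_def by (intro tendsto_divide tendsto_laplace_integral tendsto_const tendsto_intros x z Gx)
  have "((\<lambda>t. tricomi_nonint x t z) \<longlongrightarrow> F y) (at_left y)"
  proof (rule Lim_transform_eventually[OF lim])
    have "\<forall>\<^sub>F t in at_left y. t \<notin> \<int>"
      by (rule filter_leD[OF _ eventually_nonint[of y]]) (simp add: at_le)
    moreover have "\<forall>\<^sub>F t in at_left y. t < y"
      by (simp add: eventually_at_filter)
    ultimately show "\<forall>\<^sub>F t in at_left y. F t = tricomi_nonint x t z"
      by eventually_elim (use x y z in \<open>simp add: F_def tricomi_nonint_integral_lt_1\<close>)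
  qed
  moreover have "((\<lambda>t. tricomi_nonint x t z) \<longlongrightarrow> F y) (at_right y)"
  proof (cases "y = 1")
    case y1: True
    define H where "H = (\<lambda>t. z powr (1 - t) * (laplace_integral (1 + x - t) (- x) z / Gamma (1 + x - t)))"
    have limG: "((\<lambda>t. Gamma (1 + x - t)) \<longlongrightarrow> Gamma (1 + x - 1)) (at_right 1)"
      using x by (intro tendsto_Gamma tendsto_intros) (auto elim!: nonpos_Ints_cases)
    have limK: "((\<lambda>t. laplace_integral (1 + x - t) (- x) z) \<longlongrightarrow> laplace_integral x (- x) z) (at_right 1)"
    proof (rule tendsto_laplace_integral[OF x z])
      have "((\<lambda>t. 1 + x - t) \<longlongrightarrow> 1 + x - 1) (at_right 1)" by (intro tendsto_intros)
      then show "((\<lambda>t. 1 + x - t) \<longlongrightarrow> x) (at_right 1)" by simp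
    qed (rule tendsto_const)
    have limz: "((\<lambda>t. z powr (1 - t)) \<longlongrightarrow> z powr (1 - 1)) (at_right 1)"
      using z by (intro tendsto_intros) auto
    have "(H \<longlongrightarrow> z powr (1 - 1) * (laplace_integral x (- x) z / Gamma (1 + x - 1))) (at_right 1)"
      unfolding H_def
      by (rule tendsto_mult[OF limz tendsto_divide[OF limK limG]]) (use Gx in simp)
    then have "(H \<longlongrightarrow> F y) (at_right y)"
      using z y1 by (simp add: F_def)
    then show ?thesis
    proof (rule Lim_transform_eventually)
      have "\<forall>\<^sub>F t in at_right y. t \<notin> \<int>"
        by (rule filter_leD[OF _ eventually_nonint[of y]]) (simp add: at_le)
      \<comment> \<open>Keeps \<open>1 + x - t\<close> positive, as the form for
        \<open>t > 1\<close> requires.\<close>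
      moreover have "\<forall>\<^sub>F t in at_right y. t < 1 + x"
        using x y1 by (intro order_tendstoD(2)[OF tendsto_ident_at]) auto
      ultimately show "\<forall>\<^sub>F t in at_right y. H t = tricomi_nonint x t z"
        using eventually_at_right_less[of y]
        by eventually_elim (use z y1 in \<open>simp add: H_def tricomi_nonint_integral_gt_1\<close>)
    qed
  next
    case False
    then have y1: "y < 1" using y by simp
    show ?thesis
    proof (rule Lim_transform_eventually[OF lim])
      have "\<forall>\<^sub>F t in at_right y. t \<notin> \<int>"
        by (rule filter_leD[OF _ eventually_nonint[of y]]) (simp add: at_le)
      moreover have "\<forall>\<^sub>F t in at_right y. t < 1"
        using y1 by (intro order_tendstoD(2)[OF tendsto_ident_at])
      ultimately show "\<forall>\<^sub>F t in at_right y. F t = tricomi_nonint x t z"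
        by eventually_elim (use x z in \<open>simp add: F_def tricomi_nonint_integral_lt_1\<close>)
    qed
  qed
  ultimately have "((\<lambda>t. tricomi_nonint x t z) \<longlongrightarrow> F y) (at y)"
    by (rule filterlim_split_at)
  then show ?thesis using True by (simp add: tricomi_pos_def tendsto_Lim F_def)
qed

lemma tricomi_pos_gt_1:
  assumes xy: "1 + x - y > 0" and y: "y > 1" and z: "z > 0"
  shows "tricomi_pos x y z = z powr (1 - y) * (laplace_integral (1 + x - y) (- x) z / Gamma (1 + x - y))"
proof (cases "y \<in> \<int>")
  case False
  then show ?thesis using tricomi_nonint_integral_gt_1[OF xy y False z] by (simp add: tricomi_pos_def)
next
  case True
  have Gs: "Gamma (1 + x - y) \<noteq> 0" using Gamma_real_pos[OF xy] by linarith
  define H where "H = (\<lambda>t. z powr (1 - t) * (laplace_integral (1 + x - t) (- x) z / Gamma (1 + x - t)))"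
  have limG: "((\<lambda>t. Gamma (1 + x - t)) \<longlongrightarrow> Gamma (1 + x - y)) (at y)"
    using xy by (intro tendsto_Gamma tendsto_intros) (auto elim!: nonpos_Ints_cases)
  have limK: "((\<lambda>t. laplace_integral (1 + x - t) (- x) z) \<longlongrightarrow> laplace_integral (1 + x - y) (- x) z) (at y)"
    by (intro tendsto_laplace_integral[OF xy z] tendsto_intros)
  have "(H \<longlongrightarrow> H y) (at y)"
    unfolding H_def
    by (rule tendsto_mult[OF _ tendsto_divide[OF limK limG Gs]]) (use z in \<open>auto intro!: tendsto_intros\<close>)
  then have "((\<lambda>t. tricomi_nonint x t z) \<longlongrightarrow> H y) (at y)"
  proof (rule Lim_transform_eventually)
    have "\<forall>\<^sub>F t in at y. t < 1 + x" "\<forall>\<^sub>F t in at y. t > 1"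
      using xy y by (auto intro!: order_tendstoD[OF tendsto_ident_at])
    then show "\<forall>\<^sub>F t in at y. H t = tricomi_nonint x t z"
      using eventually_nonint[of y]
      by eventually_elim (use z in \<open>simp add: H_def tricomi_nonint_integral_gt_1\<close>)
  qed
  then show ?thesis using True by (simp add: tricomi_pos_def tendsto_Lim H_def)
qed

section \<open>Limits of the Tricomi function at infinity and at zero\<close>

text \<open>Both representations give the same power: for \<open>y > 1\<close> the prefactor
  contributes \<open>z powr (1 - y)\<close>, and \<open>z powr x * z powr (1 - y)\<close> is the
  normalisation of an integral with first parameter \<open>1 + x - y\<close>.\<close>

lemma tricomi_pos_at_top:
  assumes x: "x > 0" and xy: "1 + x - y > 0"
  shows "((\<lambda>z. z powr x * tricomi_pos x y z) \<longlongrightarrow> 1) at_top"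
proof (cases "y \<le> 1")
  case True
  have Gx: "Gamma x \<noteq> 0" using Gamma_real_pos[OF x] by linarith
  have "((\<lambda>z. z powr x * laplace_integral x (y - x - 1) z / Gamma x) \<longlongrightarrow> Gamma x / Gamma x) at_top"
    using x True Gx by (intro tendsto_divide laplace_integral_at_top tendsto_const) auto
  then have "((\<lambda>z. z powr x * laplace_integral x (y - x - 1) z / Gamma x) \<longlongrightarrow> 1) at_top"
    using Gx by simp
  then show ?thesis
    by (rule Lim_transform_eventually)
       (use eventually_gt_at_top[of 0] in eventually_elim, simp add: tricomi_pos_le_1 x True)
next
  case False
  define s where "s = 1 + x - y"
  have Gs: "Gamma s \<noteq> 0" using Gamma_real_pos[OF xy] unfolding s_def by linarith
  have "((\<lambda>z. z powr s * laplace_integral s (- x) z / Gamma s) \<longlongrightarrow> Gamma s / Gamma s) at_top"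
    using x xy Gs by (intro tendsto_divide laplace_integral_at_top tendsto_const) (auto simp: s_def)
  then have "((\<lambda>z. z powr s * laplace_integral s (- x) z / Gamma s) \<longlongrightarrow> 1) at_top"
    using Gs by simp
  then show ?thesis
  proof (rule Lim_transform_eventually)
    show "\<forall>\<^sub>F z in at_top. z powr s * laplace_integral s (- x) z / Gamma s = z powr x * tricomi_pos x y z"
      using eventually_gt_at_top[of 0]
    proof eventually_elim
      case (elim z)
      have "s = x + (1 - y)" by (simp add: s_def)
      then have "z powr s = z powr x * z powr (1 - y)" by (simp only: powr_add)
      then show ?case
        using tricomi_pos_gt_1[OF xy _ elim] False by (simp add: s_def)
    qed
  qed
qed

lemma tricomi_pos_at_0_finite:
  assumes x: "x > 0" and y: "y < 1"
  shows "((\<lambda>z. tricomi_pos x y z) \<longlongrightarrow> Beta x (1 - y) / Gamma x) (at_right 0)"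
proof -
  have Gx: "Gamma x \<noteq> 0" using Gamma_real_pos[OF x] by linarith
  have "((\<lambda>z. laplace_integral x (y - x - 1) z / Gamma x) \<longlongrightarrow> Beta x (- (x + (y - x - 1))) / Gamma x) (at_right 0)"
    using x y Gx by (intro tendsto_divide laplace_integral_at_0 tendsto_const) auto
  then have "((\<lambda>z. laplace_integral x (y - x - 1) z / Gamma x) \<longlongrightarrow> Beta x (1 - y) / Gamma x) (at_right 0)"
    by simp
  then show ?thesis
    by (rule Lim_transform_eventually)
       (use eventually_at_right_less[of 0] in eventually_elim, use x y in \<open>simp add: tricomi_pos_le_1\<close>)
qed

lemma laplace_integral_pos:
  assumes "p > 0" "z > 0" shows "laplace_integral p r z > 0"
proof -
  have "integral {1..(2::real)} (\<lambda>_. 0) < integral {1..2} (laplace_kernel p r z)"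
    by (intro integral_less_real integrable_continuous_real continuous_on_subset[OF continuous_on_laplace_kernel])
       (auto simp: laplace_kernel_def)
  also have "\<dots> \<le> laplace_integral p r z"
    unfolding laplace_integral_def using assms
    by (intro integral_subset_le laplace_kernel_integrable integrable_continuous_real
          continuous_on_subset[OF continuous_on_laplace_kernel]) (auto simp: laplace_kernel_nonneg)
  finally show ?thesis by simp
qed

text \<open>Divergence is logarithmic for \<open>y = 1\<close>. For \<open>y > 1\<close> it comes
  from \<open>z powr (1 - y)\<close>, since the accompanying integral decreases in \<open>z\<close>
  and for \<open>z < 1\<close> is at least its positive value at \<open>1\<close>.\<close>

lemma tricomi_pos_at_0_infinite:
  assumes x: "x > 0" and xy: "1 + x - y > 0" and y: "y \<ge> 1"
  shows "filterlim (tricomi_pos x y) at_top (at_right 0)"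
proof (cases "y = 1")
  case True
  define c where "c = exp (- 1) * 2 powr (- x) / Gamma x"
  have c: "c > 0" using Gamma_real_pos[OF x] by (simp add: c_def)
  have "filterlim (\<lambda>z. c * ln (1 / z)) at_top (at_right 0)"
    using c by real_asymp
  then show ?thesis
  proof (rule filterlim_at_top_mono)
    have "\<forall>\<^sub>F z in at_right 0. z < (1::real)" by (intro order_tendstoD(2)[OF tendsto_ident_at]) auto
    then show "\<forall>\<^sub>F z in at_right 0. c * ln (1 / z) \<le> tricomi_pos x y z"
      using eventually_at_right_less[of 0]
    proof eventually_elim
      case (elim z)
      then have "exp (- 1) * 2 powr (- x) * ln (1 / z) / Gamma x \<le> laplace_integral x (- x) z / Gamma x"
        using laplace_integral_log_lower_bound[of x z] Gamma_real_pos[OF x] x by (intro divide_right_mono) auto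
      then show ?case using tricomi_pos_le_1[of x y z] x elim True by (simp add: c_def)
    qed
  qed
next
  case False
  define s where "s = 1 + x - y"
  have y1: "y > 1" using y False by simp
  have s: "s > 0" using xy by (simp add: s_def)
  define c where "c = laplace_integral s (- x) 1 / Gamma s"
  have c: "c > 0" unfolding c_def using s by (intro divide_pos_pos laplace_integral_pos Gamma_real_pos) auto
  have "filterlim (\<lambda>z. z powr (1 - y) * c) at_top (at_right 0)"
    using c y1 by real_asymp
  then show ?thesis
  proof (rule filterlim_at_top_mono)
    have "\<forall>\<^sub>F z in at_right 0. z < (1::real)" by (intro order_tendstoD(2)[OF tendsto_ident_at]) auto
    then show "\<forall>\<^sub>F z in at_right 0. z powr (1 - y) * c \<le> tricomi_pos x y z"
      using eventually_at_right_less[of 0]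
    proof eventually_elim
      case (elim z)
      have "z powr (1 - y) * c \<le> z powr (1 - y) * (laplace_integral s (- x) z / Gamma s)"
        unfolding c_def using elim s Gamma_real_pos[OF s]
        by (intro mult_left_mono divide_right_mono laplace_integral_antimono) auto
      then show ?case using tricomi_pos_gt_1[of x y z] xy elim y1 by (simp add: s_def)
    qed
  qed
qed

section \<open>Transfer to the density\<close>

text \<open>Away from \<open>\<theta> = 0\<close> the argument of the Tricomi function is nonzero,
  so the limit branch of \<open>tricomi_Psi\<close> is avoided and the density is
  real-valued.\<close>

lemma f_density_eq:
  assumes "q > 0" "\<xi> > 0" "\<theta> \<noteq> 0"
  shows "f_density q a b \<xi> \<theta> =
    ereal (Gamma (a + 1 / q) / Gamma (1 / q) * (q / (2 * Beta a b)) * (phi q / \<xi> powr (1 / q))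
      * tricomi_pos (a + 1 / q) (1 + 1 / q - b) ((phi q * \<bar>\<theta>\<bar>) powr q / \<xi>))"
proof -
  have "phi q > 0"
    using assms Gamma_real_pos[of "3 / q"] Gamma_real_pos[of "1 / q"] by (simp add: phi_def)
  then have "(phi q * \<bar>\<theta>\<bar>) powr q / \<xi> \<noteq> 0" using assms by simp
  then show ?thesis by (simp add: f_density_def tricomi_Psi_def)
qed

theorem corollary1:
  fixes q a b \<xi> :: real
  assumes "q > 0" "a > 0" "b > 0" "\<xi> > 0"
  shows "(singularity_at_zero (f_density q a b \<xi>) \<longleftrightarrow> b \<le> 1 / q)
    \<and> (\<exists>c>0. ((\<lambda>\<theta>. f_density q a b \<xi> \<theta> / ereal (c * \<bar>\<theta>\<bar> powr (- a * q - 1))) \<longlongrightarrow> 1) at_infinity)"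
proof -
  define x y where "x = a + 1 / q" and "y = 1 + 1 / q - b"
  define C where "C = Gamma (a + 1 / q) / Gamma (1 / q) * (q / (2 * Beta a b)) * (phi q / \<xi> powr (1 / q))"
  define Z where "Z = (\<lambda>\<theta>. (phi q * \<bar>\<theta>\<bar>) powr q / \<xi>)"
  \<comment> \<open>Here \<open>1 + x - y\<close> equals \<open>a + b\<close>.\<close>
  have x: "x > 0" and xy: "1 + x - y > 0" using assms by (auto simp: x_def y_def add_pos_pos)
  have phi: "phi q > 0"
    using assms Gamma_real_pos[of "3 / q"] Gamma_real_pos[of "1 / q"] by (simp add: phi_def)
  have C: "C > 0"
    unfolding C_def Beta_def using assms phi x[unfolded x_def] by (intro mult_pos_pos divide_pos_pos Gamma_real_pos) auto
  have f: "f_density q a b \<xi> \<theta> = ereal (C * tricomi_pos x y (Z \<theta>))" if "\<theta> \<noteq> 0" for \<theta>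
    using f_density_eq[OF assms(1,4) that] by (simp add: C_def x_def y_def Z_def)
  have Z0: "filterlim Z (at_right 0) (at 0)"
  proof -
    have "((\<lambda>\<theta>. (phi q * \<bar>\<theta>\<bar>) powr q / \<xi>) \<longlongrightarrow> (phi q * \<bar>0\<bar>) powr q / \<xi>) (at 0)"
      using assms phi by (intro tendsto_intros) auto
    moreover have "\<forall>\<^sub>F \<theta> in at 0. Z \<theta> > 0"
      using eventually_neq_at_within[of 0] by eventually_elim (use assms phi in \<open>simp add: Z_def\<close>)
    ultimately show ?thesis
      using assms by (auto simp: filterlim_at Z_def elim!: eventually_mono)
  qed
  have Zinf: "filterlim Z at_top at_infinity"
  proof -
    have "filterlim (\<lambda>t. (phi q * t) powr q / \<xi>) at_top at_top"
      using assms phi by real_asymp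
    then have "filterlim (\<lambda>\<theta>. (phi q * norm \<theta>) powr q / \<xi>) at_top (at_infinity :: real filter)"
      by (rule filterlim_compose) (rule filterlim_norm_at_top)
    then show ?thesis by (simp add: Z_def)
  qed
  have yb: "y \<ge> 1 \<longleftrightarrow> b \<le> 1 / q" by (auto simp: y_def)
  have "singularity_at_zero (f_density q a b \<xi>) \<longleftrightarrow> y \<ge> 1"
  proof
    assume y: "y \<ge> 1"
    have "filterlim (\<lambda>\<theta>. C * tricomi_pos x y (Z \<theta>)) at_top (at 0)"
      using filterlim_compose[OF tricomi_pos_at_0_infinite[OF x xy y] Z0] C
      by (intro filterlim_tendsto_pos_mult_at_top[OF tendsto_const])
    then have large: "\<forall>\<^sub>F \<theta> in at 0. C * tricomi_pos x y (Z \<theta>) > B" for B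
      by (simp add: filterlim_at_top_dense)
    show "singularity_at_zero (f_density q a b \<xi>)"
      unfolding singularity_at_zero_def
    proof
      assume "\<exists>B::real. \<forall>\<^sub>F \<theta> in at 0. \<bar>f_density q a b \<xi> \<theta>\<bar> \<le> ereal B"
      then obtain B :: real where "\<forall>\<^sub>F \<theta> in at 0. \<bar>f_density q a b \<xi> \<theta>\<bar> \<le> ereal B" by blast
      \<comment> \<open>The supposed bound \<open>B\<close> is eventually exceeded, which is absurd
        because \<open>0\<close> is a limit point of the real line.\<close>
      then have "\<forall>\<^sub>F \<theta> in at (0::real). False"
        using large[of B] eventually_neq_at_within[of 0]
        by eventually_elim (simp add: f)
      then show False by simp
    qed
  next
    assume sing: "singularity_at_zero (f_density q a b \<xi>)"
    show "y \<ge> 1"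
    proof (rule ccontr)
      assume "\<not> y \<ge> 1"
      then have y: "y < 1" by simp
      define l where "l = C * (Beta x (1 - y) / Gamma x)"
      have "((\<lambda>\<theta>. C * tricomi_pos x y (Z \<theta>)) \<longlongrightarrow> l) (at 0)"
        unfolding l_def
        by (intro tendsto_mult_left filterlim_compose[OF tricomi_pos_at_0_finite[OF x y] Z0])
      then have "((\<lambda>\<theta>. \<bar>C * tricomi_pos x y (Z \<theta>)\<bar>) \<longlongrightarrow> \<bar>l\<bar>) (at 0)"
        by (rule tendsto_rabs)
      then have "\<forall>\<^sub>F \<theta> in at 0. \<bar>C * tricomi_pos x y (Z \<theta>)\<bar> < \<bar>l\<bar> + 1"
        by (rule order_tendstoD) simp
      then have "\<forall>\<^sub>F \<theta> in at 0. \<bar>f_density q a b \<xi> \<theta>\<bar> \<le> ereal (\<bar>l\<bar> + 1)"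
        using eventually_neq_at_within[of 0] by eventually_elim (simp add: f)
      then show False using sing by (auto simp: singularity_at_zero_def)
    qed
  qed
  moreover have "\<exists>c>0. ((\<lambda>\<theta>. f_density q a b \<xi> \<theta> / ereal (c * \<bar>\<theta>\<bar> powr (- a * q - 1))) \<longlongrightarrow> 1) at_infinity"
  proof (intro exI conjI)
    \<comment> \<open>Since \<open>Z \<theta> = phi q powr q / \<xi> * \<bar>\<theta>\<bar> powr
      q\<close> and \<open>q * x = a * q + 1\<close>, this \<open>c\<close> makes
      \<open>c * \<bar>\<theta>\<bar> powr (- a * q - 1)\<close> equal to
      \<open>C * Z \<theta> powr (- x)\<close>.\<close>
    define c where "c = C * (phi q powr q / \<xi>) powr (- x)"
    show c: "c > 0" using C phi assms by (simp add: c_def)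
    have "((\<lambda>\<theta>. Z \<theta> powr x * tricomi_pos x y (Z \<theta>)) \<longlongrightarrow> 1) at_infinity"
      by (rule filterlim_compose[OF tricomi_pos_at_top[OF x xy] Zinf])
    then have "((\<lambda>\<theta>. ereal (Z \<theta> powr x * tricomi_pos x y (Z \<theta>))) \<longlongrightarrow> 1) at_infinity"
      unfolding one_ereal_def by (rule tendsto_ereal)
    then show "((\<lambda>\<theta>. f_density q a b \<xi> \<theta> / ereal (c * \<bar>\<theta>\<bar> powr (- a * q - 1))) \<longlongrightarrow> 1) at_infinity"
    proof (rule Lim_transform_eventually)
      have "\<forall>\<^sub>F \<theta> in at_infinity. (\<theta>::real) \<noteq> 0"
        using eventually_not_equal_at_infinity .
      then show "\<forall>\<^sub>F \<theta> in at_infinity. ereal (Z \<theta> powr x * tricomi_pos x y (Z \<theta>))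
          = f_density q a b \<xi> \<theta> / ereal (c * \<bar>\<theta>\<bar> powr (- a * q - 1))"
      proof eventually_elim
        case (elim \<theta>)
        have "q * x = a * q + 1" using assms by (simp add: x_def field_simps)
        then have "\<bar>\<theta>\<bar> powr (- a * q - 1) = (\<bar>\<theta>\<bar> powr q) powr (- x)"
          by (simp add: powr_powr)
        moreover have "Z \<theta> = phi q powr q / \<xi> * \<bar>\<theta>\<bar> powr q"
          using phi by (simp add: Z_def powr_mult)
        ultimately have "c * \<bar>\<theta>\<bar> powr (- a * q - 1) = C * Z \<theta> powr (- x)"
          using phi assms by (simp add: c_def powr_mult powr_divide)
        moreover have "Z \<theta> > 0" using elim phi assms by (simp add: Z_def)
        ultimately show ?case
          using C c elim by (simp add: f powr_minus field_simps)
      qed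
    qed
  qed
  ultimately show ?thesis using yb by blast
qed

end
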